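(* For every integer $n\ge3$, the graph $X_n$ is a connected vertex-transitive 3-RDR graph of order $12n$, and the following holds: (i) $g(X_3)=6$ and $\mathrm{sgn}(X_3)=(0,1,1)$. (ii) For $n\ge4$, $g(X_n)=8$ and $\mathrm{sgn}(X_n)=(5,5,6)$, with $X_n\cong\mathrm{GP}(6n,2n-1)$ if $n\equiv1\pmod3$, and $X_n\cong\mathrm{GP}(6n,2n+1)$ if $n\equiv-1\pmod3$; and $X_n$ is not isomorphic to any generalized Petersen graph if $n\equiv0\pmod3$.
   Context: Definition of $X_n$: let $D_n=\langle r,z\mid r^n=z^2=(zr)^2=1\rangle$ be the dihedral group of order $2n$, $n\ge3$, let $S_3$ be the symmetric group on $\{1,2,3\}$, and let $G=S_3\times D_n$. Put $a=((1\,2),1)$, $b=((1\,3),z)$, $c=((2\,3),zr)$ (three involutions of $G$) and $S=\{a,b,c\}$. Then $X_n=\mathrm{Cay}(G,S)$ is the graph with vertex set $G$ and edge set $\{\{g,gs\}: g\in G, s\in S\}$. All graphs are finite and simple. For a graph with vertex set $V$, $N(v)$ is the open neighbourhood of $v$. A $3$-rainbow dominating function (3-RDF) is a map $f\colon V\to 2^{\{1,2,3\}}$ such that $f(v)=\emptyset$ implies $\bigcup_{u\in N(v)}f(u)=\{1,2,3\}$, for all $v\in V$; $\gamma_{r3}$ is the minimum of $\sum_{v}|f(v)|$ over all 3-RDFs. A cubic (3-regular) graph is 3-RDR (3-rainbow domination regular) if $\gamma_{r3}=|V|/2$ (the known lower bound for cubic graphs). For $1\le k\le n/2$, the generalized Petersen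 graph $\mathrm{GP}(n,k)$ has vertex set $\{u_i,v_i: i\in\mathbb Z_n\}$ and edges $\{u_i,u_{i+1}\}$, $\{u_i,v_i\}$, $\{v_i,v_{i+k}\}$, $i\in\mathbb Z_n$. The girth $g(X)$ is the length of a shortest cycle of $X$; cycles of this length are girth cycles. For an edge $e$, $\epsilon(e)$ is the number of girth cycles containing $e$. The signature of a vertex $v$ of degree $3$ is the triple of values $\epsilon(e)$ of the three edges at $v$, in non-decreasing order. In a vertex-transitive graph all vertex signatures coincide, and the common value is the signature $\mathrm{sgn}(X)$. *)

theory Defs
  imports
    "Graph_Theory.Pair_Digraph"
    "Graph_Theory.Digraph_Isomorphism"
    "HOL-Algebra.Sym_Groups"
    "HOL-Library.Extended_Nat"
    "HOL-Number_Theory.Cong"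
begin

section \<open>Finite simple graphs\<close>

text \<open>
  A finite simple graph is a \<^locale>\<open>pair_graph\<close>: a finite, loop-free, symmetric set of arcs.
  The edge \<open>{u, v}\<close> is represented by the two arcs \<open>(u, v)\<close> and \<open>(v, u)\<close>.
\<close>

definition graph_of_edges :: "'a set \<Rightarrow> 'a set set \<Rightarrow> 'a pair_pre_digraph" where
  "graph_of_edges V E = \<lparr> pverts = V, parcs = {(u, v). {u, v} \<in> E} \<rparr>"

definition neighbourhood :: "'a pair_pre_digraph \<Rightarrow> 'a \<Rightarrow> 'a set" where
  "neighbourhood X v = {u. (v, u) \<in> parcs X}"

definition cubic :: "'a pair_pre_digraph \<Rightarrow> bool" where
  "cubic X \<longleftrightarrow> (\<forall>v \<in> pverts X. card (neighbourhood X v) = 3)"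

definition vertex_transitive :: "'a pair_pre_digraph \<Rightarrow> bool" where
  "vertex_transitive X \<longleftrightarrow>
     (\<forall>u \<in> pverts X. \<forall>v \<in> pverts X.
        \<exists>h. pre_digraph.digraph_isomorphism (with_proj X) h \<and>
            app_iso h (with_proj X) = with_proj X \<and> iso_verts h u = v)"


section \<open>Girth and signature\<close>

text \<open>
  A cycle is a subgraph, represented by its set of edges; in particular neither a starting point
  nor an orientation is part of it.  The library's \<^const>\<open>pre_digraph.cycle\<close> also admits the
  closed walk \<open>(u, v), (v, u)\<close>, which is not a cycle of a simple graph and is excluded by the
  bound on the length.
\<close>

definition cycles :: "'a pair_pre_digraph \<Rightarrow> 'a set set set" where
  "cycles X = {(\<lambda>(u, v). {u, v}) ` set p | p. pre_digraph.cycle (with_proj X) p \<and> 3 \<le> length p}"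

text \<open>The girth is infinite if there are no cycles.\<close>

definition girth :: "'a pair_pre_digraph \<Rightarrow> enat" where
  "girth X = (INF C \<in> cycles X. enat (card C))"

definition girth_cycles :: "'a pair_pre_digraph \<Rightarrow> 'a set set set" where
  "girth_cycles X = {C \<in> cycles X. enat (card C) = girth X}"

definition girth_cycles_through :: "'a pair_pre_digraph \<Rightarrow> 'a set \<Rightarrow> nat" where
  "girth_cycles_through X e = card {C \<in> girth_cycles X. e \<in> C}"

text \<open>The numbers for the edges at \<open>v\<close>, with multiplicity and in non-decreasing order.\<close>

definition vertex_signature :: "'a pair_pre_digraph \<Rightarrow> 'a \<Rightarrow> nat list" where
  "vertex_signature X v =
     sorted_list_of_multiset
       (image_mset (\<lambda>u. girth_cycles_through X {v, u}) (mset_set (neighbourhood X v)))"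

definition has_signature :: "'a pair_pre_digraph \<Rightarrow> nat list \<Rightarrow> bool" where
  "has_signature X s \<longleftrightarrow> pverts X \<noteq> {} \<and> (\<forall>v \<in> pverts X. vertex_signature X v = s)"


section \<open>3-rainbow domination\<close>

definition rainbow_dominating3 :: "'a pair_pre_digraph \<Rightarrow> ('a \<Rightarrow> nat set) \<Rightarrow> bool" where
  "rainbow_dominating3 X f \<longleftrightarrow>
     (\<forall>v \<in> pverts X. f v \<subseteq> {1, 2, 3}) \<and>
     (\<forall>v \<in> pverts X. f v = {} \<longrightarrow> (\<Union>u \<in> neighbourhood X v. f u) = {1, 2, 3})"

definition rainbow_domination_number3 :: "'a pair_pre_digraph \<Rightarrow> nat" where
  "rainbow_domination_number3 X =
     (LEAST w. \<exists>f. rainbow_dominating3 X f \<and> w = (\<Sum>v \<in> pverts X. card (f v)))"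

definition rainbow_domination_regular3 :: "'a pair_pre_digraph \<Rightarrow> bool" where
  "rainbow_domination_regular3 X \<longleftrightarrow>
     cubic X \<and> real (rainbow_domination_number3 X) = real (card (pverts X)) / 2"


section \<open>Generalized Petersen graphs\<close>

text \<open>\<open>Outer i\<close> is \<open>u\<^sub>i\<close> and \<open>Inner i\<close> is \<open>v\<^sub>i\<close>; the indices in \<open>\<int>\<^sub>n\<close> are represented by \<open>0, \<dots>, n - 1\<close>.\<close>

datatype petersen_vertex = Outer nat | Inner nat

definition gen_petersen :: "nat \<Rightarrow> nat \<Rightarrow> petersen_vertex pair_pre_digraph" where
  "gen_petersen n k = graph_of_edges
     (Outer ` {0..<n} \<union> Inner ` {0..<n})
     ({{Outer i, Outer ((i + 1) mod n)} | i. i < n} \<union>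
      {{Outer i, Inner i} | i. i < n} \<union>
      {{Inner i, Inner ((i + k) mod n)} | i. i < n})"


section \<open>The dihedral groups\<close>

text \<open>
  The pair \<open>(i, e)\<close> with \<open>0 \<le> i < n\<close> stands for \<open>r\<^sup>i\<close> if \<open>e\<close> is false and for \<open>r\<^sup>i z\<close> if \<open>e\<close>
  is true.  That this is the group presented by \<open>r\<^sup>n = z\<^sup>2 = (z r)\<^sup>2 = 1\<close> is shown below:
  it is a group generated by \<open>r\<close> and \<open>z\<close>, these satisfy the relations, and they can be mapped to any
  two elements of any group that satisfy the relations.
\<close>

definition dihedral_group :: "nat \<Rightarrow> (int \<times> bool) monoid" where
  "dihedral_group n =
     \<lparr> carrier = {0..<int n} \<times> UNIV,
       mult = (\<lambda>(i, e) (j, e'). ((if e then i - j else i + j) mod int n, e \<noteq> e')),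
       one = (0, False) \<rparr>"

definition dih_r :: "int \<times> bool" where "dih_r = (1, False)"

definition dih_z :: "int \<times> bool" where "dih_z = (0, True)"

lemma group_dihedral_group:
  assumes "n \<ge> 3"
  shows "group (dihedral_group n)"
proof (rule groupI)
  show "\<one>\<^bsub>dihedral_group n\<^esub> \<in> carrier (dihedral_group n)"
    using assms by (simp add: dihedral_group_def)
next
  fix x assume "x \<in> carrier (dihedral_group n)"
  then obtain i e where x: "x = (i, e)" and i: "0 \<le> i" "i < int n"
    by (auto simp: dihedral_group_def)
  show "\<exists>y\<in>carrier (dihedral_group n). y \<otimes>\<^bsub>dihedral_group n\<^esub> x = \<one>\<^bsub>dihedral_group n\<^esub>"
  proof (cases e)
    case True
    then show ?thesis using x i by (intro bexI[of _ x]) (auto simp: dihedral_group_def)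
  next
    case False
    then show ?thesis using x i
      by (intro bexI[of _ "((- i) mod int n, False)"]) (auto simp: dihedral_group_def mod_simps)
  qed
qed (use assms in \<open>auto simp: dihedral_group_def mod_simps algebra_simps split: if_splits\<close>)

lemma order_dihedral_group: "order (dihedral_group n) = 2 * n"
  by (simp add: order_def dihedral_group_def card_cartesian_product)

lemma dih_pow_r:
  assumes "n \<ge> 3"
  shows "dih_r [^]\<^bsub>dihedral_group n\<^esub> (k::nat) = (int k mod int n, False)"
proof (induction k)
  case 0
  then show ?case using assms by (simp add: nat_pow_def dihedral_group_def)
next
  case (Suc k)
  interpret D: group "dihedral_group n" using group_dihedral_group[OF assms] .
  show ?case
    using Suc by (simp add: dih_r_def dihedral_group_def mod_simps algebra_simps)
qed

lemma dihedral_group_relations: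
  assumes "n \<ge> 3"
  shows "dih_r \<in> carrier (dihedral_group n)" "dih_z \<in> carrier (dihedral_group n)"
    and "dih_r [^]\<^bsub>dihedral_group n\<^esub> n = \<one>\<^bsub>dihedral_group n\<^esub>"
    and "dih_z [^]\<^bsub>dihedral_group n\<^esub> (2::nat) = \<one>\<^bsub>dihedral_group n\<^esub>"
    and "(dih_z \<otimes>\<^bsub>dihedral_group n\<^esub> dih_r) [^]\<^bsub>dihedral_group n\<^esub> (2::nat) = \<one>\<^bsub>dihedral_group n\<^esub>"
proof -
  interpret D: group "dihedral_group n" using group_dihedral_group[OF assms] .
  show c: "dih_r \<in> carrier (dihedral_group n)" "dih_z \<in> carrier (dihedral_group n)"
    using assms by (auto simp: dihedral_group_def dih_r_def dih_z_def)
  show "dih_r [^]\<^bsub>dihedral_group n\<^esub> n = \<one>\<^bsub>dihedral_group n\<^esub>"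
    using dih_pow_r[OF assms, of n] by (simp add: dihedral_group_def)
  show "dih_z [^]\<^bsub>dihedral_group n\<^esub> (2::nat) = \<one>\<^bsub>dihedral_group n\<^esub>"
    using assms by (simp add: numeral_2_eq_2 dihedral_group_def dih_z_def)
  show "(dih_z \<otimes>\<^bsub>dihedral_group n\<^esub> dih_r) [^]\<^bsub>dihedral_group n\<^esub> (2::nat) = \<one>\<^bsub>dihedral_group n\<^esub>"
    using assms by (simp add: numeral_2_eq_2 dihedral_group_def dih_z_def dih_r_def)
qed

lemma dihedral_group_generated:
  assumes "n \<ge> 3"
  shows "generate (dihedral_group n) {dih_r, dih_z} = carrier (dihedral_group n)"
proof
  interpret D: group "dihedral_group n" using group_dihedral_group[OF assms] .
  let ?H = "generate (dihedral_group n) {dih_r, dih_z}"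
  show "?H \<subseteq> carrier (dihedral_group n)"
    using dihedral_group_relations[OF assms] by (intro D.generate_incl) auto
  show "carrier (dihedral_group n) \<subseteq> ?H"
  proof
    fix x assume "x \<in> carrier (dihedral_group n)"
    then obtain i e where x: "x = (i, e)" and i: "0 \<le> i" "i < int n"
      by (auto simp: dihedral_group_def)
    have pw: "dih_r [^]\<^bsub>dihedral_group n\<^esub> (k::nat) \<in> ?H" for k
      by (induction k) (auto intro: generate.intros)
    have r: "(i, False) \<in> ?H"
      using pw[of "nat i"] i by (simp add: dih_pow_r[OF assms])
    have "(i, False) \<otimes>\<^bsub>dihedral_group n\<^esub> dih_z \<in> ?H"
      by (rule generate.eng[OF r]) (auto intro: generate.intros)
    then have "(i, True) \<in> ?H" using i by (simp add: dihedral_group_def dih_z_def)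
    with r x show "x \<in> ?H" by (cases e) auto
  qed
qed

lemma dihedral_group_universal:
  assumes n: "n \<ge> 3" and "group H" and xy: "x \<in> carrier H" "y \<in> carrier H"
    and rels: "x [^]\<^bsub>H\<^esub> n = \<one>\<^bsub>H\<^esub>" "y [^]\<^bsub>H\<^esub> (2::nat) = \<one>\<^bsub>H\<^esub>" "(y \<otimes>\<^bsub>H\<^esub> x) [^]\<^bsub>H\<^esub> (2::nat) = \<one>\<^bsub>H\<^esub>"
  shows "\<exists>h \<in> hom (dihedral_group n) H. h dih_r = x \<and> h dih_z = y"
proof -
  interpret H: group H by fact
  have yy: "y \<otimes>\<^bsub>H\<^esub> y = \<one>\<^bsub>H\<^esub>"
    using rels(2) xy by (simp add: numeral_2_eq_2)
  have yx: "y \<otimes>\<^bsub>H\<^esub> x \<otimes>\<^bsub>H\<^esub> y = inv\<^bsub>H\<^esub> x"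
    using rels(3) xy by (intro H.inv_equality[symmetric]) (simp_all add: numeral_2_eq_2 H.m_assoc)
  have per: "x [^]\<^bsub>H\<^esub> (i mod int n) = x [^]\<^bsub>H\<^esub> (i::int)" for i
  proof -
    have "x [^]\<^bsub>H\<^esub> i = x [^]\<^bsub>H\<^esub> (int n * (i div int n) + i mod int n)" by simp
    also have "\<dots> = (x [^]\<^bsub>H\<^esub> int n) [^]\<^bsub>H\<^esub> (i div int n) \<otimes>\<^bsub>H\<^esub> x [^]\<^bsub>H\<^esub> (i mod int n)"
      using xy by (simp only: H.int_pow_mult H.int_pow_pow)
    finally show ?thesis using rels(1) xy by (simp add: int_pow_int)
  qed
  have conj_nat: "y \<otimes>\<^bsub>H\<^esub> x [^]\<^bsub>H\<^esub> (k::nat) \<otimes>\<^bsub>H\<^esub> y = x [^]\<^bsub>H\<^esub> (- int k)" for k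
  proof (induction k)
    case 0
    then show ?case using xy yy by simp
  next
    case (Suc k)
    have "y \<otimes>\<^bsub>H\<^esub> x [^]\<^bsub>H\<^esub> Suc k \<otimes>\<^bsub>H\<^esub> y
        = (y \<otimes>\<^bsub>H\<^esub> x [^]\<^bsub>H\<^esub> k \<otimes>\<^bsub>H\<^esub> y) \<otimes>\<^bsub>H\<^esub> (y \<otimes>\<^bsub>H\<^esub> x \<otimes>\<^bsub>H\<^esub> y)"
      using xy yy by (simp add: H.m_assoc) (simp add: H.m_assoc[symmetric])
    also have "\<dots> = x [^]\<^bsub>H\<^esub> (- int k) \<otimes>\<^bsub>H\<^esub> x [^]\<^bsub>H\<^esub> (- 1 :: int)"
      using Suc yx xy by (simp add: H.int_pow_neg)
    also have "\<dots> = x [^]\<^bsub>H\<^esub> (- int (Suc k))"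
      using xy by (simp add: H.int_pow_mult[symmetric] algebra_simps)
    finally show ?case .
  qed
  have conj: "y \<otimes>\<^bsub>H\<^esub> x [^]\<^bsub>H\<^esub> i = x [^]\<^bsub>H\<^esub> (- i) \<otimes>\<^bsub>H\<^esub> y" if "0 \<le> i" for i :: int
  proof -
    have "x [^]\<^bsub>H\<^esub> (- i) \<otimes>\<^bsub>H\<^esub> y = (y \<otimes>\<^bsub>H\<^esub> x [^]\<^bsub>H\<^esub> i \<otimes>\<^bsub>H\<^esub> y) \<otimes>\<^bsub>H\<^esub> y"
      using conj_nat[of "nat i"] that by (simp add: int_pow_int[symmetric])
    also have "\<dots> = y \<otimes>\<^bsub>H\<^esub> x [^]\<^bsub>H\<^esub> i"
      using xy yy by (simp add: H.m_assoc)
    finally show ?thesis ..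
  qed
  define h where "h = (\<lambda>(i::int, e). x [^]\<^bsub>H\<^esub> i \<otimes>\<^bsub>H\<^esub> (if e then y else \<one>\<^bsub>H\<^esub>))"
  have "h \<in> hom (dihedral_group n) H"
  proof (rule homI)
    show "h a \<in> carrier H" if "a \<in> carrier (dihedral_group n)" for a
      using xy by (cases a) (auto simp: h_def)
  next
    fix a b assume ab: "a \<in> carrier (dihedral_group n)" "b \<in> carrier (dihedral_group n)"
    obtain i e j e' where [simp]: "a = (i, e)" "b = (j, e')" by (cases a, cases b)
    have j: "0 \<le> j" using ab by (simp add: dihedral_group_def)
    let ?t = "if e' then y else \<one>\<^bsub>H\<^esub>"
    have t: "?t \<in> carrier H" using xy by simp
    show "h (a \<otimes>\<^bsub>dihedral_group n\<^esub> b) = h a \<otimes>\<^bsub>H\<^esub> h b"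
    proof (cases e)
      case True
      have "h a \<otimes>\<^bsub>H\<^esub> h b = x [^]\<^bsub>H\<^esub> i \<otimes>\<^bsub>H\<^esub> (y \<otimes>\<^bsub>H\<^esub> x [^]\<^bsub>H\<^esub> j) \<otimes>\<^bsub>H\<^esub> ?t"
        using True xy t by (simp add: h_def H.m_assoc)
      also have "\<dots> = x [^]\<^bsub>H\<^esub> i \<otimes>\<^bsub>H\<^esub> x [^]\<^bsub>H\<^esub> (- j) \<otimes>\<^bsub>H\<^esub> (y \<otimes>\<^bsub>H\<^esub> ?t)"
        unfolding conj[OF j] using xy t by (simp add: H.m_assoc)
      also have "\<dots> = x [^]\<^bsub>H\<^esub> (i - j) \<otimes>\<^bsub>H\<^esub> (y \<otimes>\<^bsub>H\<^esub> ?t)"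
        using xy by (simp add: H.int_pow_mult[symmetric])
      finally show ?thesis
        using True xy yy by (simp add: h_def dihedral_group_def per)
    next
      case False
      have "h a \<otimes>\<^bsub>H\<^esub> h b = x [^]\<^bsub>H\<^esub> (i + j) \<otimes>\<^bsub>H\<^esub> ?t"
        using False xy t by (simp add: h_def H.m_assoc H.int_pow_mult)
      then show ?thesis
        using False by (simp add: h_def dihedral_group_def per)
    qed
  qed
  moreover have "h dih_r = x" "h dih_z = y"
    using xy by (simp_all add: h_def dih_r_def dih_z_def)
  ultimately show ?thesis by blast
qed


section \<open>The Cayley graphs\<close>

definition cayley_graph :: "('a, 'b) monoid_scheme \<Rightarrow> 'a set \<Rightarrow> 'a pair_pre_digraph" where
  "cayley_graph G S =
     graph_of_edges (carrier G) {{g, g \<otimes>\<^bsub>G\<^esub> s} | g s. g \<in> carrier G \<and> s \<in> S}"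

definition X_graph :: "nat \<Rightarrow> ((nat \<Rightarrow> nat) \<times> (int \<times> bool)) pair_pre_digraph" where
  "X_graph n = cayley_graph (sym_group 3 \<times>\<times> dihedral_group n)
     {(transpose 1 2, \<one>\<^bsub>dihedral_group n\<^esub>),
      (transpose 1 3, dih_z),
      (transpose 2 3, dih_z \<otimes>\<^bsub>dihedral_group n\<^esub> dih_r)}"

end

theory Submission
  imports Defs
begin

text \<open>
  Identify \<open>{1, 2, 3}\<close> with \<open>\<int>\<^sub>3\<close>.  The permutations are then the maps \<open>x \<mapsto> j \<plusminus> x\<close>, so that elements of
  \<open>S\<^sub>3 \<times> D\<^sub>n\<close> have coordinates in two dihedral groups.  Cycles through a given edge of a Cayley graph
  of the girth length are reduced words in the generators that evaluate to \<open>1\<close>.  If \<open>n \<ge> 4\<close>, the words of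
  length at most \<open>8\<close> that are trivial up to a power \<open>r\<^sup>i\<close> have \<open>\<bar>i\<bar> \<le> 3\<close>, and so being trivial does
  not depend on \<open>n\<close> and the relations can be enumerated in \<open>S\<^sub>3 \<times> D\<^sub>\<infinity>\<close>.

  Colouring \<open>(\<sigma>, d)\<close> by \<open>\<sigma>(1)\<close> if \<open>\<sigma>\<close> is even, and by nothing if \<open>\<sigma>\<close> is odd, is a rainbow dominating
  function of weight \<open>6 n\<close>: multiplication on the right by the three transpositions moves \<open>1\<close> to
  all three points.

  If \<open>3\<close> does not divide \<open>n\<close>, then \<open>b c\<close> has order \<open>3 n\<close>, and the alternating products of \<open>b\<close> and
  \<open>c\<close> and their translates by \<open>a\<close> are the outer and the inner vertices of the generalized Petersen
  graph.  If \<open>3\<close> divides \<open>n\<close>, an isomorphism with a generalized Petersen graph would map the outer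
  cycle, whose edges all lie on the same number of \<open>8\<close>-cycles, to edges labelled \<open>b\<close> or \<open>c\<close>; but
  a coset of \<open>\<langle>b, c\<rangle>\<close> has just \<open>2 n\<close> elements, fewer than the \<open>6 n\<close> outer vertices.
\<close>

section \<open>Cycles as closed paths\<close>

text \<open>Each vertex is listed once, from a chosen start in a chosen direction; indices modulo
  the length make the closing arc one like the others.\<close>

definition closed_path :: "'a pair_pre_digraph \<Rightarrow> 'a list \<Rightarrow> bool" where
  "closed_path X xs \<longleftrightarrow> 3 \<le> length xs \<and> distinct xs \<and>
     (\<forall>i<length xs. (xs ! i, xs ! (Suc i mod length xs)) \<in> parcs X)"

definition closed_path_edges :: "'a list \<Rightarrow> 'a set set" where
  "closed_path_edges xs = (\<lambda>i. {xs ! i, xs ! (Suc i mod length xs)}) ` {..<length xs}"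

text \<open>Replaces the recursive chain condition by a single list equation, whose entries and
  multisets can be compared directly.\<close>

lemma pcas_iff: "pcas u p v \<longleftrightarrow> u # map snd p = map fst p @ [v]"
  by (induction p arbitrary: u) auto

lemma pawalk_verts_eq: "pcas u p v \<Longrightarrow> pawalk_verts u p = map fst p @ [v]"
  by (induction p arbitrary: u) auto

lemma Suc_mod_less: "i < L \<Longrightarrow> Suc i mod L = (if Suc i = L then 0 else Suc i)"
  by auto

text \<open>Arc lists and vertex lists determine each other: take the tails of the arcs, or pair
  each vertex with its cyclic successor.\<close>

lemma cycles_eq:
  assumes "pair_wf_digraph X"
  shows "cycles X = closed_path_edges ` {xs. closed_path X xs}"
proof (intro equalityI subsetI)
  interpret pair_wf_digraph X by fact
  fix C assume "C \<in> cycles X"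
  then obtain p u where C: "C = (\<lambda>(u, v). {u, v}) ` set p" and L: "3 \<le> length p"
    and arcs: "set p \<subseteq> parcs X" and cas: "pcas u p u"
    and dist: "distinct (tl (pawalk_verts u p))"
    unfolding cycles_def cycle_def awalk_def by auto
  have eq: "u # map snd p = map fst p @ [u]" using cas by (simp add: pcas_iff)
  let ?xs = "map fst p"
  have u: "u = ?xs ! 0" using L eq by (cases p) auto
  have nth: "p ! i = (?xs ! i, ?xs ! (Suc i mod length p))" if i: "i < length p" for i
  proof -
    have "snd (p ! i) = (u # map snd p) ! Suc i" using i by simp
    also have "\<dots> = (?xs @ [u]) ! Suc i" by (simp only: eq)
    also have "\<dots> = ?xs ! (Suc i mod length p)"
      using i u by (auto simp: nth_append Suc_mod_less)
    finally show ?thesis using i by (simp add: prod_eq_iff)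
  qed
  \<comment> \<open>Distinctness is known for the heads of the arcs and wanted for the tails.
    Cancelling \<open>u\<close> on both sides of \<open>eq\<close> shows that these form the same
    multiset.\<close>
  have "mset ?xs = mset (map snd p)"
    using arg_cong[OF eq, of mset] by simp
  moreover have "distinct (map snd p)"
  proof -
    have "tl (pawalk_verts u p) = tl (u # map snd p)"
      using pawalk_verts_eq[OF cas] eq by simp
    then show ?thesis using dist by simp
  qed
  ultimately have "distinct ?xs" by (metis mset_eq_imp_distinct_iff)
  moreover have "(?xs ! i, ?xs ! (Suc i mod length ?xs)) \<in> parcs X" if "i < length ?xs" for i
  proof -
    have "p ! i \<in> parcs X" using arcs that by (auto intro!: nth_mem)
    then show ?thesis using nth[of i] that by simp
  qed
  ultimately have "closed_path X ?xs" using L by (simp add: closed_path_def)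
  moreover have "C = closed_path_edges ?xs"
  proof -
    have "set p = (\<lambda>i. p ! i) ` {..<length p}" by (simp add: set_conv_nth lessThan_def setcompr_eq_image)
    then have "C = (\<lambda>i. case p ! i of (u, v) \<Rightarrow> {u, v}) ` {..<length p}"
      unfolding C by (simp only: image_image)
    also have "\<dots> = closed_path_edges ?xs"
      unfolding closed_path_edges_def by (rule image_cong) (simp, subst nth, auto)
    finally show ?thesis .
  qed
  ultimately show "C \<in> closed_path_edges ` {xs. closed_path X xs}" by blast
next
  interpret pair_wf_digraph X by fact
  fix C assume "C \<in> closed_path_edges ` {xs. closed_path X xs}"
  then obtain xs where C: "C = closed_path_edges xs" and xs: "closed_path X xs" by blast
  let ?L = "length xs"
  let ?p = "map (\<lambda>i. (xs ! i, xs ! (Suc i mod ?L))) [0..<?L]"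
  have L: "3 \<le> ?L" and dist: "distinct xs" using xs by (auto simp: closed_path_def)
  have "xs ! 0 # map snd ?p = xs @ [xs ! 0]"
  proof (rule nth_equalityI)
    fix i assume "i < length (xs ! 0 # map snd ?p)"
    then show "(xs ! 0 # map snd ?p) ! i = (xs @ [xs ! 0]) ! i"
      using L by (cases i) (auto simp: nth_append Suc_mod_less)
  qed simp
  moreover have fst: "map fst ?p = xs" by (auto intro: nth_equalityI)
  ultimately have cas: "pcas (xs ! 0) ?p (xs ! 0)" by (simp add: pcas_iff)
  have "awalk (xs ! 0) ?p (xs ! 0)"
    unfolding awalk_def
  proof (intro conjI)
    have "(xs ! 0, xs ! (Suc 0 mod ?L)) \<in> parcs X"
      using xs L unfolding closed_path_def by (metis gr_zeroI not_numeral_le_zero)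
    then show "xs ! 0 \<in> pverts X" by (rule in_arcsD1)
    show "set ?p \<subseteq> parcs X" using xs by (auto simp: closed_path_def)
  qed (rule cas)
  moreover have "distinct (tl (pawalk_verts (xs ! 0) ?p))"
    unfolding pawalk_verts_eq[OF cas] fst using L dist
    by (cases xs) auto
  ultimately have "cycle ?p" using L unfolding cycle_def by (intro exI[of _ "xs ! 0"]) auto
  moreover have "C = (\<lambda>(u, v). {u, v}) ` set ?p"
    unfolding C closed_path_edges_def by (auto simp: image_image)
  ultimately show "C \<in> cycles X" using L unfolding cycles_def by (intro CollectI exI[of _ ?p]) simp
qed

text \<open>Equal edges at different positions would make each position the cyclic successor of the
  other, which at least three vertices exclude.\<close>

lemma card_closed_path_edges:
  assumes "closed_path X xs"
  shows "card (closed_path_edges xs) = length xs"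
proof -
  have "inj_on (\<lambda>i. {xs ! i, xs ! (Suc i mod length xs)}) {..<length xs}"
  proof (rule inj_onI)
    fix i j assume ij: "i \<in> {..<length xs}" "j \<in> {..<length xs}"
      and eq: "{xs ! i, xs ! (Suc i mod length xs)} = {xs ! j, xs ! (Suc j mod length xs)}"
    have L: "3 \<le> length xs" "distinct xs" and ne: "xs \<noteq> []" using assms by (auto simp: closed_path_def)
    have lt: "Suc k mod length xs < length xs" for k using L by (intro mod_less_divisor) linarith
    show "i = j"
      using eq ij lt nth_eq_iff_index_eq[OF L(2)] L(1) ne
      by (auto simp: doubleton_eq_iff Suc_mod_less split: if_splits)
  qed
  then show ?thesis by (simp add: closed_path_edges_def card_image)
qed

lemma girth_eqI:
  assumes "pair_wf_digraph X" "closed_path X xs"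
    and "\<And>ys. closed_path X ys \<Longrightarrow> length xs \<le> length ys"
  shows "girth X = enat (length xs)"
  unfolding girth_def cycles_eq[OF assms(1)]
proof (rule antisym)
  show "(INF C\<in>closed_path_edges ` {xs. closed_path X xs}. enat (card C)) \<le> enat (length xs)"
    using assms(2) by (intro INF_lower2[of "closed_path_edges xs"])
      (auto simp: card_closed_path_edges)
  show "enat (length xs) \<le> (INF C\<in>closed_path_edges ` {xs. closed_path X xs}. enat (card C))"
    using assms(3) by (intro INF_greatest) (auto simp: card_closed_path_edges)
qed

text \<open>One inclusion of the edge sets is enough, because both sets have as many elements as the
  path has vertices.\<close>

lemma closed_path_rotate:
  assumes "closed_path X xs"
  shows "closed_path X (rotate k xs)" "closed_path_edges (rotate k xs) = closed_path_edges xs"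
proof -
  let ?L = "length xs"
  have L: "3 \<le> ?L" "distinct xs" using assms by (auto simp: closed_path_def)
  have lt: "k mod ?L < ?L" for k using L by (intro mod_less_divisor) linarith
  have nth: "rotate k xs ! i = xs ! ((k + i) mod ?L)"
    "rotate k xs ! (Suc i mod ?L) = xs ! (Suc ((k + i) mod ?L) mod ?L)" if "i < ?L" for i
    using that lt[of "Suc i"] by (simp_all add: nth_rotate mod_simps)
  show *: "closed_path X (rotate k xs)"
    unfolding closed_path_def
  proof (intro conjI allI impI)
    fix i assume "i < length (rotate k xs)"
    then have i: "i < ?L" by simp
    show "(rotate k xs ! i, rotate k xs ! (Suc i mod length (rotate k xs))) \<in> parcs X"
      unfolding length_rotate nth[OF i] using assms lt by (auto simp: closed_path_def)
  qed (use L in auto)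
  have "closed_path_edges (rotate k xs) \<subseteq> closed_path_edges xs"
  proof
    fix e assume "e \<in> closed_path_edges (rotate k xs)"
    then obtain i where i: "i < ?L" "e = {rotate k xs ! i, rotate k xs ! (Suc i mod ?L)}"
      unfolding closed_path_edges_def by auto
    then show "e \<in> closed_path_edges xs"
      unfolding nth[OF i(1)] closed_path_edges_def using lt by auto
  qed
  then show "closed_path_edges (rotate k xs) = closed_path_edges xs"
    using card_closed_path_edges[OF assms] card_closed_path_edges[OF *]
    by (intro card_subset_eq) (auto simp: closed_path_edges_def)
qed

lemma closed_path_rev:
  assumes "closed_path X xs" "sym (parcs X)"
  shows "closed_path X (rev xs)" "closed_path_edges (rev xs) = closed_path_edges xs"
proof -
  let ?L = "length xs"
  \<comment> \<open>The edge at position \<open>i\<close> of \<open>rev xs\<close> is the edge at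
    position \<open>r i\<close> of \<open>xs\<close>; the closing edge is last in both
    lists.\<close>
  define r where "r i = (if Suc i = ?L then i else ?L - 2 - i)" for i
  have L: "3 \<le> ?L" "xs \<noteq> []" using assms by (auto simp: closed_path_def)
  have last: "?L - Suc 0 = i" if "Suc i = ?L" for i using that by linarith
  have r: "r i < ?L" "rev xs ! (Suc i mod ?L) = xs ! r i" "rev xs ! i = xs ! (Suc (r i) mod ?L)"
    if "i < ?L" for i
    using that L by (auto simp: r_def rev_nth last Suc_mod_less Suc_diff_Suc numeral_2_eq_2 simp flip: length_greater_0_conv)
  show *: "closed_path X (rev xs)"
    using assms r unfolding closed_path_def by (auto intro: symD[OF assms(2)])
  have "closed_path_edges (rev xs) \<subseteq> closed_path_edges xs"
    using r unfolding closed_path_edges_def by (auto simp: insert_commute)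
  then show "closed_path_edges (rev xs) = closed_path_edges xs"
    using card_closed_path_edges[OF assms(1)] card_closed_path_edges[OF *]
    by (intro card_subset_eq) (auto simp: closed_path_edges_def)
qed

section \<open>Counting girth cycles by paths with a fixed first edge\<close>

definition closed_paths_from :: "'a pair_pre_digraph \<Rightarrow> nat \<Rightarrow> 'a \<Rightarrow> 'a \<Rightarrow> 'a list set" where
  "closed_paths_from X L u v = {xs. closed_path X xs \<and> length xs = L \<and> xs ! 0 = u \<and> xs ! 1 = v}"

text \<open>Past its first edge, a path is determined by its edge set: the successor of a vertex is the
  neighbour other than the predecessor.\<close>

lemma closed_path_edges_inj:
  assumes "closed_path X xs" "closed_path X ys" "closed_path_edges xs = closed_path_edges ys"
    and "xs ! 0 = ys ! 0" "xs ! 1 = ys ! 1"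
  shows "xs = ys"
proof (rule nth_equalityI)
  show len: "length xs = length ys"
    using card_closed_path_edges[OF assms(1)] card_closed_path_edges[OF assms(2)] assms(3) by simp
  let ?L = "length xs"
  have L: "3 \<le> ?L" and dx: "distinct xs" and dy: "distinct ys"
    using assms by (auto simp: closed_path_def)
  have "xs ! i = ys ! i \<and> xs ! Suc i = ys ! Suc i" if "Suc i < ?L" for i
    using that
  proof (induction i)
    case 0
    then show ?case using assms by simp
  next
    case (Suc i)
    then have IH: "xs ! i = ys ! i" "xs ! Suc i = ys ! Suc i" by auto
    have "{xs ! Suc i, xs ! Suc (Suc i)} \<in> closed_path_edges xs"
      unfolding closed_path_edges_def using Suc.prems by (intro image_eqI[of _ _ "Suc i"]) auto
    then have "{ys ! Suc i, xs ! Suc (Suc i)} \<in> closed_path_edges ys"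
      using IH assms(3) by simp
    then obtain j where j: "j < ?L" "{ys ! Suc i, xs ! Suc (Suc i)} = {ys ! j, ys ! (Suc j mod ?L)}"
      unfolding closed_path_edges_def len by auto
    have jj: "Suc j mod ?L < ?L" using L by (intro mod_less_divisor) linarith
    have "xs ! Suc (Suc i) \<noteq> xs ! i"
      using dx Suc.prems by (simp add: nth_eq_iff_index_eq)
    then have ne: "xs ! Suc (Suc i) \<noteq> ys ! i" using IH by simp
    from j(2) consider "ys ! Suc i = ys ! j" "xs ! Suc (Suc i) = ys ! (Suc j mod ?L)"
      | "ys ! Suc i = ys ! (Suc j mod ?L)" "xs ! Suc (Suc i) = ys ! j"
      by (auto simp: doubleton_eq_iff)
    then have "xs ! Suc (Suc i) = ys ! Suc (Suc i)"
    proof cases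
      case 1
      then have "j = Suc i" using dy j(1) Suc.prems len by (simp add: nth_eq_iff_index_eq)
      then show ?thesis using 1 Suc.prems by simp
    next
      case 2
      then have "Suc j mod ?L = Suc i" using dy jj Suc.prems len by (simp add: nth_eq_iff_index_eq)
      then have "j = i" using j(1) by (auto simp: Suc_mod_less split: if_splits)
      then show ?thesis using 2 ne by simp
    qed
    then show ?case using IH by simp
  qed
  then show "xs ! i = ys ! i" if "i < ?L" for i
    using that L by (cases i) auto
qed

text \<open>Rotation, with reversal if necessary, lets any girth cycle through the edge start with
  \<open>u\<close>, \<open>v\<close>, and in one way only. Thus edge sets are counted as vertex
  lists.\<close>

lemma girth_cycles_through_eq:
  assumes wf: "pair_wf_digraph X" and sym: "sym (parcs X)" and girth: "girth X = enat L"
  shows "girth_cycles_through X {u, v} = card (closed_paths_from X L u v)"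
proof -
  have "bij_betw closed_path_edges (closed_paths_from X L u v) {C \<in> girth_cycles X. {u, v} \<in> C}"
    unfolding bij_betw_def
  proof (intro conjI equalityI subsetI)
    show "inj_on closed_path_edges (closed_paths_from X L u v)"
      by (auto simp: inj_on_def closed_paths_from_def intro: closed_path_edges_inj)
  next
    fix C assume "C \<in> closed_path_edges ` closed_paths_from X L u v"
    then obtain xs where xs: "closed_path X xs" "length xs = L" "xs ! 0 = u" "xs ! 1 = v"
      and C: "C = closed_path_edges xs" by (auto simp: closed_paths_from_def)
    have "3 \<le> L" using xs by (auto simp: closed_path_def)
    then have "{u, v} \<in> C"
      unfolding C closed_path_edges_def using xs by (intro image_eqI[of _ _ 0]) auto
    then show "C \<in> {C \<in> girth_cycles X. {u, v} \<in> C}"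
      using xs C by (auto simp: girth_cycles_def cycles_eq[OF wf] card_closed_path_edges girth)
  next
    fix C assume "C \<in> {C \<in> girth_cycles X. {u, v} \<in> C}"
    then obtain xs where xs: "closed_path X xs" "length xs = L" and C: "C = closed_path_edges xs"
      and uv: "{u, v} \<in> C"
      by (auto simp: girth_cycles_def cycles_eq[OF wf] card_closed_path_edges girth)
    have L: "3 \<le> L" using xs by (auto simp: closed_path_def)
    from uv obtain i where i: "i < L" "{u, v} = {xs ! i, xs ! (Suc i mod L)}"
      unfolding C closed_path_edges_def using xs by auto
    define ys where "ys = rotate i xs"
    have ys: "closed_path X ys" "length ys = L" "closed_path_edges ys = C"
      using closed_path_rotate[OF xs(1)] xs C by (auto simp: ys_def)
    have y: "{u, v} = {ys ! 0, ys ! 1}"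
      using i L xs by (simp add: ys_def nth_rotate)
    show "C \<in> closed_path_edges ` closed_paths_from X L u v"
    proof (cases "u = ys ! 0 \<and> v = ys ! 1")
      case True
      then show ?thesis using ys by (auto simp: closed_paths_from_def)
    next
      case False
      then have u: "u = ys ! 1" "v = ys ! 0" using y by (auto simp: doubleton_eq_iff)
      \<comment> \<open>In \<open>rev ys\<close> the entries \<open>ys ! 1\<close> and
        \<open>ys ! 0\<close> stand at positions \<open>L - 2\<close> and \<open>L - 1\<close>; the
        rotation brings them to the front.\<close>
      define zs where "zs = rotate (L - 2) (rev ys)"
      have "closed_path X zs" "length zs = L" "closed_path_edges zs = C"
        using closed_path_rotate[OF closed_path_rev(1)[OF ys(1) sym]] closed_path_rev[OF ys(1) sym] ys
        by (auto simp: zs_def)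
      moreover have "zs ! 0 = u" "zs ! 1 = v"
        using L ys u by (simp_all add: zs_def nth_rotate rev_nth)
      ultimately show ?thesis by (auto simp: closed_paths_from_def)
    qed
  qed
  then show ?thesis by (simp add: girth_cycles_through_def bij_betw_same_card)
qed

section \<open>Cayley graphs with respect to involutions\<close>

text \<open>The library's isomorphisms also carry an arc map and head and tail functions; for arcs
  that are pairs the vertex map fixes all of them.\<close>

abbreviation pair_iso :: "('a \<Rightarrow> 'b) \<Rightarrow> ('a, 'a \<times> 'a, 'b, 'b \<times> 'b) digraph_isomorphism" where
  "pair_iso f \<equiv> \<lparr> iso_verts = f, iso_arcs = map_prod f f, iso_head = snd, iso_tail = fst \<rparr>"

lemma pair_iso:
  assumes "pair_wf_digraph X" "inj_on f (pverts X)"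
    and "pverts Y = f ` pverts X" "parcs Y = map_prod f f ` parcs X"
  shows "pre_digraph.digraph_isomorphism (with_proj X) (pair_iso f)"
    and "app_iso (pair_iso f) (with_proj X) = with_proj Y"
proof -
  interpret pair_wf_digraph X by fact
  have "inj_on (map_prod f f) (parcs X)"
    by (intro inj_on_subset[OF map_prod_inj_on[OF assms(2) assms(2)]])
      (auto dest: in_arcsD1 in_arcsD2)
  then show "pre_digraph.digraph_isomorphism (with_proj X) (pair_iso f)"
    using assms(2) wf_digraph_axioms by (auto simp: pre_digraph.digraph_isomorphism_def)
  show "app_iso (pair_iso f) (with_proj X) = with_proj Y"
    using assms(3,4) by (simp add: app_iso_def with_proj_def)
qed

text \<open>Generators are indexed by letters so that words are lists. As each is its own inverse,
  arcs come in both directions, and a word is reduced when no two adjacent letters agree.\<close>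

locale involution_cayley = group G for G (structure) +
  fixes gen :: "'s :: finite \<Rightarrow> 'a"
  assumes finite_carrier: "finite (carrier G)"
    and gen_closed [simp, intro]: "gen s \<in> carrier G"
    and gen_involution [simp]: "gen s \<otimes> gen s = \<one>"
    and gen_ne_one: "gen s \<noteq> \<one>"
    and inj_gen: "inj gen"
begin

abbreviation X :: "'a pair_pre_digraph" where
  "X \<equiv> cayley_graph G (range gen)"

lemma pverts_X [simp]: "pverts X = carrier G"
  by (simp add: cayley_graph_def graph_of_edges_def)

lemma mult_gen_gen [simp]: "g \<in> carrier G \<Longrightarrow> g \<otimes> gen s \<otimes> gen s = g"
  by (simp add: m_assoc)

lemma parcs_X_iff: "(u, v) \<in> parcs X \<longleftrightarrow> u \<in> carrier G \<and> (\<exists>s. v = u \<otimes> gen s)"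
proof -
  have "(u, v) \<in> parcs X \<longleftrightarrow> (\<exists>g s. {u, v} = {g, g \<otimes> gen s} \<and> g \<in> carrier G)"
    by (auto simp: cayley_graph_def graph_of_edges_def)
  also have "\<dots> \<longleftrightarrow> u \<in> carrier G \<and> (\<exists>s. v = u \<otimes> gen s)"
  proof
    assume "\<exists>g s. {u, v} = {g, g \<otimes> gen s} \<and> g \<in> carrier G"
    then obtain g s where g: "g \<in> carrier G"
      and "u = g \<and> v = g \<otimes> gen s \<or> u = g \<otimes> gen s \<and> v = g"
      by (auto simp: doubleton_eq_iff)
    then have "u \<in> carrier G \<and> v = u \<otimes> gen s" by auto
    then show "u \<in> carrier G \<and> (\<exists>s. v = u \<otimes> gen s)" by blast
  qed blast
  finally show ?thesis .
qed

lemma pair_graph_X: "pair_graph X"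
proof
  show "finite (parcs X)"
    by (rule finite_subset[of _ "carrier G \<times> carrier G"])
      (auto simp: parcs_X_iff finite_carrier)
  show "symmetric (with_proj X)"
    by (auto simp: symmetric_def sym_def parcs_X_iff) (metis mult_gen_gen)
  show "fst e \<noteq> snd e" if "e \<in> parcs X" for e
    using that gen_ne_one by (cases e) (auto simp: parcs_X_iff)
qed (auto simp: parcs_X_iff finite_carrier)

lemma pair_wf_digraph_X: "pair_wf_digraph X"
  using pair_graph_X by (simp add: pair_graph_def pair_digraph_def pair_fin_digraph_def)

lemma sym_parcs_X: "sym (parcs X)"
  by (auto simp: sym_def parcs_X_iff) (metis mult_gen_gen)

lemma neighbourhood_X: "g \<in> carrier G \<Longrightarrow> neighbourhood X g = (\<lambda>s. g \<otimes> gen s) ` UNIV"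
  by (auto simp: neighbourhood_def parcs_X_iff)

lemma inj_mult_gen: "g \<in> carrier G \<Longrightarrow> inj (\<lambda>s. g \<otimes> gen s)"
  using inj_gen by (auto simp: inj_def)

lemma card_neighbourhood_X: "g \<in> carrier G \<Longrightarrow> card (neighbourhood X g) = card (UNIV :: 's set)"
  by (simp add: neighbourhood_X card_image inj_mult_gen)

text \<open>Edges arise by multiplication on the right, so multiplication on the left by
  \<open>v \<otimes> inv u\<close> is an automorphism, and it takes \<open>u\<close> to
  \<open>v\<close>.\<close>

lemma vertex_transitive_X: "vertex_transitive X"
  unfolding vertex_transitive_def
proof (intro ballI)
  fix u v assume uv: "u \<in> pverts X" "v \<in> pverts X"
  define f where "f = (\<lambda>g. v \<otimes> inv u \<otimes> g)"
  have c: "v \<otimes> inv u \<in> carrier G" using uv by simp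
  have surj: "f ` carrier G = carrier G"
    using surj_const_mult[OF c] by (simp add: f_def)
  have "parcs X = map_prod f f ` parcs X"
  proof (intro equalityI subsetI)
    fix e assume "e \<in> parcs X"
    then obtain g s where e: "e = (g, g \<otimes> gen s)" "g \<in> carrier G"
      by (cases e) (auto simp: parcs_X_iff)
    then obtain h where h: "h \<in> carrier G" "g = f h" using surj by auto
    then have "e = map_prod f f (h, h \<otimes> gen s)" using c by (simp add: e f_def m_assoc)
    moreover have "(h, h \<otimes> gen s) \<in> parcs X" using h by (auto simp: parcs_X_iff)
    ultimately show "e \<in> map_prod f f ` parcs X" by blast
  next
    fix e assume "e \<in> map_prod f f ` parcs X"
    then obtain g s where "e = (f g, f (g \<otimes> gen s))" "g \<in> carrier G"
      by (auto simp: parcs_X_iff)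
    then have "e = (f g, f g \<otimes> gen s)" "f g \<in> carrier G" using c by (simp_all add: f_def m_assoc)
    then show "e \<in> parcs X" by (auto simp: parcs_X_iff)
  qed
  moreover have "inj_on f (pverts X)" using inj_on_cmult[OF c] by (simp add: f_def)
  ultimately have "pre_digraph.digraph_isomorphism (with_proj X) (pair_iso f)"
    and "app_iso (pair_iso f) (with_proj X) = with_proj X"
    using pair_iso[OF pair_wf_digraph_X, of f X] surj by auto
  moreover have "f u = v" using uv by (simp add: f_def m_assoc)
  ultimately show "\<exists>h. pre_digraph.digraph_isomorphism (with_proj X) h \<and>
      app_iso h (with_proj X) = with_proj X \<and> iso_verts h u = v"
    by (intro exI[of _ "pair_iso f"]) simp
qed

section \<open>Words in the generators and closed walks\<close>

definition word :: "'s list \<Rightarrow> 'a" where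
  "word w = foldr (\<lambda>s g. gen s \<otimes> g) w \<one>"

lemma word_simps [simp]: "word [] = \<one>" "word (s # w) = gen s \<otimes> word w"
  by (simp_all add: word_def)

lemma word_closed [simp, intro]: "word w \<in> carrier G"
  by (induction w) auto

lemma word_append: "word (u @ v) = word u \<otimes> word v"
  by (induction u) (auto simp: m_assoc)

text \<open>The letters of a word label a walk from \<open>g\<close> to \<open>g\<close> times the
  word, so generation by the involutions gives reachability.\<close>

lemma connected_X:
  assumes "\<And>g. g \<in> carrier G \<Longrightarrow> \<exists>w. g = word w"
  shows "Digraph_Component.connected (with_proj X)"
proof -
  interpret pair_graph X by (rule pair_graph_X)
  have reach: "g \<rightarrow>\<^sup>*\<^bsub>with_proj X\<^esub> (g \<otimes> word w)" if "g \<in> carrier G" for g w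
    using that
  proof (induction w arbitrary: g)
    case Nil
    then show ?case by simp
  next
    case (Cons s w)
    have "(g, g \<otimes> gen s) \<in> parcs X" using Cons.prems by (auto simp: parcs_X_iff)
    moreover have "(g \<otimes> gen s) \<rightarrow>\<^sup>*\<^bsub>with_proj X\<^esub> (g \<otimes> gen s \<otimes> word w)"
      using Cons.prems by (intro Cons.IH) simp
    ultimately show ?case using Cons.prems
      by (simp add: m_assoc adj_reachable_trans)
  qed
  have "u \<rightarrow>\<^sup>*\<^bsub>with_proj X\<^esub> v" if uv: "u \<in> carrier G" "v \<in> carrier G" for u v
  proof -
    obtain w where "inv u \<otimes> v = word w" using assms[of "inv u \<otimes> v"] uv by auto
    then have "u \<otimes> word w = v" using uv by (metis inv_closed l_one m_assoc r_inv)
    then show ?thesis using reach[OF uv(1), of w] by simp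
  qed
  then have "strongly_connected (with_proj X)"
    unfolding strongly_connected_def using one_closed by auto
  \<comment> \<open>The library defines connectedness through the symmetric closure, which changes
    nothing for a symmetric graph.\<close>
  moreover have "mk_symmetric (with_proj X) = X"
  proof -
    have "(\<Union>e\<in>parcs X. {e, (snd e, fst e)}) = parcs X"
      using arcs_symmetric by fastforce
    then show ?thesis by (simp add: mk_symmetric_def)
  qed
  ultimately show ?thesis by (simp add: connected_def)
qed

text \<open>Only proper prefixes of the word are used: for a trivial word the end of the walk is its
  start, which is to be listed once.\<close>

definition walk :: "'a \<Rightarrow> 's list \<Rightarrow> 'a list" where
  "walk g w = map (\<lambda>i. g \<otimes> word (take i w)) [0..<length w]"

lemma length_walk [simp]: "length (walk g w) = length w"
  by (simp add: walk_def)

lemma nth_walk [simp]: "i < length w \<Longrightarrow> walk g w ! i = g \<otimes> word (take i w)"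
  by (simp add: walk_def)

lemma nth_walk_Suc:
  assumes "g \<in> carrier G" "word w = \<one>" "i < length w"
  shows "walk g w ! (Suc i mod length w) = walk g w ! i \<otimes> gen (w ! i)"
proof -
  have "walk g w ! i \<otimes> gen (w ! i) = g \<otimes> word (take (Suc i) w)"
    using assms by (simp add: take_Suc_conv_app_nth word_append m_assoc)
  also have "\<dots> = walk g w ! (Suc i mod length w)"
  proof (cases "Suc i = length w")
    case True
    moreover have "walk g w ! 0 = g" using assms by (subst nth_walk) auto
    ultimately show ?thesis using assms by simp
  next
    case False
    then have "Suc i < length w" using assms by simp
    then show ?thesis by simp
  qed
  finally show ?thesis by simp
qed

text \<open>Label each arc by its generator. Closing up makes the word trivial, and two equal
  adjacent letters would lead back to the vertex two places earlier, which is impossible with three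
  or more distinct vertices.\<close>

lemma closed_path_word:
  assumes "closed_path X xs"
  obtains w where "length w = length xs" "distinct_adj w" "word w = \<one>" "xs = walk (xs ! 0) w"
proof -
  let ?L = "length xs"
  have L: "3 \<le> ?L" and dist: "distinct xs"
    and adj: "\<And>i. i < ?L \<Longrightarrow> (xs ! i, xs ! (Suc i mod ?L)) \<in> parcs X"
    using assms by (auto simp: closed_path_def)
  have "\<forall>i. \<exists>s. i < ?L \<longrightarrow> xs ! (Suc i mod ?L) = xs ! i \<otimes> gen s"
    using adj by (auto simp: parcs_X_iff)
  then obtain c where c: "\<And>i. i < ?L \<Longrightarrow> xs ! (Suc i mod ?L) = xs ! i \<otimes> gen (c i)"
    by metis
  have carr: "xs ! i \<in> carrier G" if "i < ?L" for i
    using adj[OF that] by (simp add: parcs_X_iff)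
  have lt: "k mod ?L < ?L" for k using L by (intro mod_less_divisor) linarith
  define w where "w = map c [0..<?L]"
  have len: "length w = ?L" by (simp add: w_def)
  have 0: "xs ! 0 \<in> carrier G" using carr[of 0] L by (cases xs) auto
  have nth: "xs ! (k mod ?L) = xs ! 0 \<otimes> word (take k w)" if "k \<le> ?L" for k
    using that
  proof (induction k)
    case 0
    then show ?case using \<open>xs ! 0 \<in> carrier G\<close> by simp
  next
    case (Suc k)
    then have "xs ! (Suc k mod ?L) = xs ! 0 \<otimes> word (take k w) \<otimes> gen (w ! k)"
      using c[of k] by (simp add: w_def)
    also have "\<dots> = xs ! 0 \<otimes> word (take (Suc k) w)"
      using Suc.prems \<open>xs ! 0 \<in> carrier G\<close> len
      by (simp add: take_Suc_conv_app_nth word_append m_assoc)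
    finally show ?case .
  qed
  have "word w = \<one>" using nth[of ?L] 0 len by simp
  moreover have "distinct_adj w"
    unfolding distinct_adj_conv_nth
  proof (intro allI impI notI)
    fix i assume i: "Suc i < length w" and eq: "w ! i = w ! Suc i"
    then have i': "Suc i < ?L" using len by simp
    have "xs ! (Suc (Suc i) mod ?L) = xs ! i \<otimes> gen (c i) \<otimes> gen (c (Suc i))"
      using c[of i] c[of "Suc i"] i' by simp
    also have "\<dots> = xs ! i" using eq i' carr[of i] by (simp add: w_def)
    finally have "Suc (Suc i) mod ?L = i"
      using dist lt i' by (simp add: nth_eq_iff_index_eq)
    then show False using i' L by (auto simp: Suc_mod_less[OF i'] split: if_splits)
  qed
  moreover have "xs = walk (xs ! 0) w"
  proof (rule nth_equalityI)
    show "xs ! i = walk (xs ! 0) w ! i" if "i < length xs" for i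
      using nth[of i] that len by simp
  qed (simp add: len)
  ultimately show thesis using that len by blast
qed

text \<open>A repeated vertex would cut out a nonempty proper factor of \<open>w\<close> that is
  reduced and trivial, against \<open>shorter\<close>.\<close>

lemma closed_path_walk:
  assumes g: "g \<in> carrier G" and w: "3 \<le> length w" "distinct_adj w" "word w = \<one>"
    and shorter: "\<And>v. v \<noteq> [] \<Longrightarrow> length v < length w \<Longrightarrow> distinct_adj v \<Longrightarrow> word v \<noteq> \<one>"
  shows "closed_path X (walk g w)"
proof -
  have ne: "walk g w ! i \<noteq> walk g w ! j" if "i < j" "j < length w" for i j
  proof
    assume eq: "walk g w ! i = walk g w ! j"
    define v where "v = take (j - i) (drop i w)"
    have split: "take j w = take i w @ v"
      using that by (simp add: v_def flip: take_add)
    then have "word v = \<one>"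
      using eq that g by (simp add: word_append m_assoc)
    moreover have "w = take i w @ v @ drop j w"
      by (metis append.assoc append_take_drop_id split)
    then have "distinct_adj v" using w(2) by (metis distinct_adj_append_iff)
    moreover have "v \<noteq> []" "length v < length w" using that by (auto simp: v_def)
    ultimately show False using shorter by blast
  qed
  have "distinct (walk g w)"
    unfolding distinct_conv_nth using ne by (metis length_walk linorder_neqE_nat)
  moreover have "walk g w ! i \<in> carrier G" if "i < length w" for i
    using that g by simp
  ultimately show ?thesis
    using w g by (auto simp: closed_path_def nth_walk_Suc parcs_X_iff simp del: nth_walk)
qed

text \<open>Words and paths correspond under \<open>walk g\<close>: each letter can be recovered
  from two cyclically successive vertices, the first one from the edge at \<open>g\<close>.\<close>

lemma card_closed_paths_from:
  assumes g: "g \<in> carrier G" and L: "3 \<le> L"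
    and shorter: "\<And>v. v \<noteq> [] \<Longrightarrow> length v < L \<Longrightarrow> distinct_adj v \<Longrightarrow> word v \<noteq> \<one>"
  shows "card (closed_paths_from X L g (g \<otimes> gen s)) =
    card {w. length w = L \<and> distinct_adj w \<and> word w = \<one> \<and> hd w = s}" (is "_ = card ?W")
proof -
  have walk1: "walk g w ! 0 = g" "walk g w ! 1 = g \<otimes> gen (hd w)" if "length w = L" for w
    using that L g by (cases w; simp)+
  have "bij_betw (walk g) ?W (closed_paths_from X L g (g \<otimes> gen s))"
    unfolding bij_betw_def
  proof (intro conjI equalityI subsetI)
    show "inj_on (walk g) ?W"
    proof (rule inj_onI, rule nth_equalityI)
      fix v w i assume vw: "v \<in> ?W" "w \<in> ?W" "walk g v = walk g w" and i: "i < length v"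
      then have "walk g v ! i \<otimes> gen (v ! i) = walk g v ! i \<otimes> gen (w ! i)"
        using nth_walk_Suc[OF g, of v i] nth_walk_Suc[OF g, of w i] by (simp del: nth_walk)
      then show "v ! i = w ! i" using i g inj_gen by (auto dest: injD)
    qed auto
  next
    fix xs assume "xs \<in> walk g ` ?W"
    then obtain w where w: "length w = L" "distinct_adj w" "word w = \<one>" "hd w = s" "xs = walk g w"
      by blast
    then have "closed_path X xs" using closed_path_walk[OF g] shorter L by blast
    then show "xs \<in> closed_paths_from X L g (g \<otimes> gen s)"
      using walk1[OF w(1)] w by (simp add: closed_paths_from_def)
  next
    fix xs assume "xs \<in> closed_paths_from X L g (g \<otimes> gen s)"
    then have xs: "closed_path X xs" "length xs = L" "xs ! 0 = g" "xs ! 1 = g \<otimes> gen s"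
      by (auto simp: closed_paths_from_def)
    obtain w where w: "length w = length xs" "distinct_adj w" "word w = \<one>" "xs = walk g w"
      using closed_path_word[OF xs(1)] xs(3) by metis
    then have "g \<otimes> gen (hd w) = g \<otimes> gen s" using walk1 xs by metis
    then have "hd w = s" using g inj_gen by (auto dest: injD)
    then show "xs \<in> walk g ` ?W" using w xs by auto
  qed
  then show ?thesis by (simp add: bij_betw_same_card)
qed

text \<open>Cycles yield trivial reduced words of the same length, and a shortest such word yields a
  cycle.\<close>

lemma girth_X:
  assumes shorter: "\<And>v. v \<noteq> [] \<Longrightarrow> length v < length w \<Longrightarrow> distinct_adj v \<Longrightarrow> word v \<noteq> \<one>"
    and w: "3 \<le> length w" "distinct_adj w" "word w = \<one>"
  shows "girth X = enat (length w)"
proof -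
  have "girth X = enat (length (walk \<one> w))"
  proof (rule girth_eqI[OF pair_wf_digraph_X])
    show "closed_path X (walk \<one> w)" using w shorter by (intro closed_path_walk) auto
    fix ys assume ys: "closed_path X ys"
    obtain v where v: "length v = length ys" "distinct_adj v" "word v = \<one>"
      by (rule closed_path_word[OF ys])
    moreover have "v \<noteq> []" using v ys by (auto simp: closed_path_def)
    ultimately show "length (walk \<one> w) \<le> length ys"
      using shorter[of v] by (metis length_walk not_le)
  qed
  then show ?thesis by simp
qed

end

section \<open>Coordinates on the group\<close>

datatype letter = La | Lb | Lc

lemma UNIV_letter: "UNIV = {La, Lb, Lc}"
  by (auto intro: letter.exhaust)

instance letter :: finite
  by standard (simp add: UNIV_letter)

lemma card_letter: "card (UNIV :: letter set) = 3"
  by (simp add: UNIV_letter)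

text \<open>Identifying \<open>{1, 2, 3}\<close> with \<open>\<int>\<^sub>3\<close>, the elements of \<open>S\<^sub>3\<close> are the maps \<open>x \<mapsto> j \<plusminus> x\<close>; the three
  transpositions are the reflections \<open>x \<mapsto> j - x\<close>.\<close>

definition perm3 :: "int \<Rightarrow> bool \<Rightarrow> nat \<Rightarrow> nat" where
  "perm3 j e x = (if x \<in> {1..3} then nat (((if e then j - int x else j + int x) - 1) mod 3) + 1 else x)"

text \<open>Residues modulo 3 are represented by 1, 2, 3, hence the shift by 1 around
  \<open>mod\<close>; remainders are nonnegative, so \<open>nat\<close> loses nothing.\<close>

lemma int_perm3:
  "x \<in> {1..3} \<Longrightarrow> int (perm3 j e x) = ((if e then j - int x else j + int x) - 1) mod 3 + 1"
  by (simp add: perm3_def)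

lemma perm3_in: "x \<in> {1..3} \<Longrightarrow> perm3 j e x \<in> {1..3}"
  by (auto simp: perm3_def)

lemma perm3_transpose:
  "perm3 0 True = transpose 1 2" "perm3 1 True = transpose 1 3" "perm3 2 True = transpose 2 3"
proof -
  have "perm3 0 True x = transpose 1 2 x \<and> perm3 1 True x = transpose 1 3 x \<and>
    perm3 2 True x = transpose 2 3 x" for x
  proof (cases "x = 1 \<or> x = 2 \<or> x = 3")
    case False
    then have "x \<notin> {1..3}" by auto
    then show ?thesis using False by (simp add: perm3_def transpose_def)
  qed (auto simp: perm3_def)
  then show "perm3 0 True = transpose 1 2" "perm3 1 True = transpose 1 3"
    "perm3 2 True = transpose 2 3" by auto
qed

lemma perm3_id: "perm3 0 False = id"
  by (auto simp: perm3_def fun_eq_iff)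

lemma perm3_comp: "perm3 j e \<circ> perm3 j' e' = perm3 (if e then j - j' else j + j') (e \<noteq> e')"
proof
  fix x
  show "(perm3 j e \<circ> perm3 j' e') x = perm3 (if e then j - j' else j + j') (e \<noteq> e') x"
  proof (cases "x \<in> {1..3}")
    case True
    \<comment> \<open>\<open>t\<close> is the image of \<open>x\<close> before reduction modulo 3.
      Replacing \<open>y\<close> by \<open>t\<close> leaves the outer residue unchanged, and what
      remains is a composition of affine maps over the integers.\<close>
    define t where "t = (if e' then j' - int x else j' + int x)"
    define y where "y = perm3 j' e' x"
    have y: "y \<in> {1..3}" "int y = (t - 1) mod 3 + 1"
      using True by (simp_all only: y_def t_def perm3_in int_perm3)
    have "int ((perm3 j e \<circ> perm3 j' e') x) = ((if e then j - int y else j + int y) - 1) mod 3 + 1"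
      using int_perm3[OF y(1)] by (simp add: y_def)
    also have "((if e then j - int y else j + int y) - 1) mod 3 = ((if e then j - t else j + t) - 1) mod 3"
    proof -
      have "(j - 2 - (t - 1) mod 3) mod 3 = (j - 2 - (t - 1)) mod 3"
        "(j + (t - 1) mod 3) mod 3 = (j + (t - 1)) mod 3" by (rule mod_simps)+
      moreover have "j - int y - 1 = j - 2 - (t - 1) mod 3" "j + int y - 1 = j + (t - 1) mod 3"
        "j - t - 1 = j - 2 - (t - 1)" "j + t - 1 = j + (t - 1)" by (simp_all add: y(2))
      ultimately show ?thesis by (cases e) (simp_all only: if_True if_False)
    qed
    also have "(if e then j - t else j + t) = (if e \<noteq> e' then (if e then j - j' else j + j') - int x
        else (if e then j - j' else j + j') + int x)"
      by (simp add: t_def)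
    finally show ?thesis using int_perm3[OF True] by (metis of_nat_eq_iff)
  qed (auto simp: perm3_def)
qed

text \<open>The points 1 and 2 suffice: with unequal signs the differences of values at the two
  points would differ by 2 or -2, which 3 does not divide; with equal signs one point determines
  \<open>j\<close> modulo 3.\<close>

lemma perm3_eq_iff: "perm3 j e = perm3 j' e' \<longleftrightarrow> j mod 3 = j' mod 3 \<and> e = e'"
proof
  assume eq: "perm3 j e = perm3 j' e'"
  have *: "3 dvd (if e then j - int x else j + int x) - (if e' then j' - int x else j' + int x)"
    if "x \<in> {1..3}" for x
  proof -
    have "((if e then j - int x else j + int x) - 1) mod 3 =
        ((if e' then j' - int x else j' + int x) - 1) mod 3"
      using int_perm3[OF that, of j e] int_perm3[OF that, of j' e'] eq by (metis add_right_cancel)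
    then show ?thesis by (simp add: mod_eq_dvd_iff)
  qed
  have 1: "1 \<in> {1..3::nat}" and 2: "2 \<in> {1..3::nat}" by simp_all
  show "j mod 3 = j' mod 3 \<and> e = e'"
    using *[OF 1] dvd_diff[OF *[OF 1] *[OF 2]] by (cases e; cases e') (auto simp: mod_eq_dvd_iff)
next
  assume *: "j mod 3 = j' mod 3 \<and> e = e'"
  then have "((if e then j - y else j + y) - 1) mod 3 = ((if e' then j' - y else j' + y) - 1) mod 3" for y
    by (auto simp: mod_eq_dvd_iff)
  then show "perm3 j e = perm3 j' e'" by (simp only: perm3_def fun_eq_iff simp_thms)
qed

lemma perm3_permutes: "perm3 j e permutes {1..3}"
proof (rule bij_imp_permutes)
  have inv: "perm3 j e \<circ> perm3 (if e then j else - j) e = id" for j e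
    using perm3_comp[of j e "if e then j else - j" e] perm3_id by (cases e) auto
  show "bij_betw (perm3 j e) {1..3} {1..3}"
    using inv[of j e] inv[of "if e then j else - j" e] perm3_in
    by (intro bij_betw_byWitness[of _ "perm3 (if e then j else - j) e"])
      (auto simp: fun_eq_iff split: if_splits)
  show "perm3 j e x = x" if "x \<notin> {1..3}" for x using that by (auto simp: perm3_def)
qed

text \<open>These are six distinct maps among the \<open>3! = 6\<close> permutations.\<close>

lemma permutes3_eq: "{p. p permutes {1..3}} = (\<lambda>(j, e). perm3 j e) ` ({0..<3} \<times> UNIV)"
proof (rule sym, rule card_subset_eq)
  have "inj_on (\<lambda>(j, e). perm3 j e) ({0..<3} \<times> UNIV)"
    by (auto simp: inj_on_def perm3_eq_iff)
  then have "card ((\<lambda>(j, e). perm3 j e) ` ({0..<3} \<times> UNIV)) = 6"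
    by (simp add: card_image card_cartesian_product)
  also have "\<dots> = card {p. p permutes {1..3::nat}}"
    by (simp add: card_permutations[OF refl] numeral_eq_Suc)
  finally show "card ((\<lambda>(j, e). perm3 j e) ` ({0..<3} \<times> UNIV)) = card {p. p permutes {1..3::nat}}" .
qed (use perm3_permutes in \<open>auto simp: finite_permutations\<close>)

section \<open>Integer coordinates for the product of the two groups\<close>

type_synonym coords = "int \<times> bool \<times> int \<times> bool"

text \<open>No reduction takes place: \<open>(j, e)\<close> describes the factor \<open>S_3\<close>
  with \<open>j\<close> read modulo 3, and \<open>(i, f)\<close> the factor \<open>D_n\<close> with
  \<open>i\<close> read modulo \<open>n\<close>. One integer computation thus serves every
  \<open>n\<close>.\<close>

fun coords_mult :: "coords \<Rightarrow> coords \<Rightarrow> coords" where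
  "coords_mult (j, e, i, f) (j', e', i', f') =
     (if e then j - j' else j + j', e \<noteq> e', if f then i - i' else i + i', f \<noteq> f')"

text \<open>The \<open>-1\<close> for \<open>Lc\<close> arises from \<open>z r = r^(-1) z\<close> in
  the normal form \<open>r^i z\<close>.\<close>

primrec letter_coords :: "letter \<Rightarrow> coords" where
  "letter_coords La = (0, True, 0, False)"
| "letter_coords Lb = (1, True, 0, True)"
| "letter_coords Lc = (2, True, -1, True)"

primrec word_coords :: "letter list \<Rightarrow> coords" where
  "word_coords [] = (0, False, 0, False)"
| "word_coords (s # w) = coords_mult (letter_coords s) (word_coords w)"

text \<open>The modulus \<open>m = 0\<close> stands for the infinite dihedral group.\<close>

definition trivial_coords :: "int \<Rightarrow> coords \<Rightarrow> bool" where
  "trivial_coords m c \<longleftrightarrow> (case c of (j, e, i, f) \<Rightarrow> j mod 3 = 0 \<and> \<not> e \<and> i mod m = 0 \<and> \<not> f)"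

locale X_coords =
  fixes n :: nat
  assumes n: "n \<ge> 3"
begin

definition G :: "((nat \<Rightarrow> nat) \<times> (int \<times> bool)) monoid" where
  "G = sym_group 3 \<times>\<times> dihedral_group n"

fun elt :: "coords \<Rightarrow> (nat \<Rightarrow> nat) \<times> (int \<times> bool)" where
  "elt (j, e, i, f) = (perm3 j e, (i mod int n, f))"

definition gen :: "letter \<Rightarrow> (nat \<Rightarrow> nat) \<times> (int \<times> bool)" where
  "gen s = elt (letter_coords s)"

declare elt.simps [simp del]

lemma elt_eq_iff:
  "elt (j, e, i, f) = elt (j', e', i', f') \<longleftrightarrow>
     j mod 3 = j' mod 3 \<and> e = e' \<and> i mod int n = i' mod int n \<and> f = f'"
  by (auto simp: elt.simps perm3_eq_iff)

lemma carrier_G: "carrier G = range elt"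
proof (intro equalityI subsetI)
  fix g assume "g \<in> carrier G"
  then obtain p i f where g: "g = (p, (i, f))" "p permutes {1..3}" "0 \<le> i" "i < int n"
    by (auto simp: G_def sym_group_def dihedral_group_def)
  from g(2) have "p \<in> (\<lambda>(j, e). perm3 j e) ` ({0..<3} \<times> UNIV)"
    using permutes3_eq by blast
  then obtain j e where "p = perm3 j e" by auto
  then have "g = elt (j, e, i, f)" using g by (simp add: elt.simps)
  then show "g \<in> range elt" by blast
next
  fix g assume "g \<in> range elt"
  then obtain c where "g = elt c" by blast
  then show "g \<in> carrier G"
    using perm3_permutes n
    by (cases c rule: elt.cases) (simp add: G_def sym_group_def dihedral_group_def elt.simps)
qed

lemma elt_closed [simp, intro]: "elt c \<in> carrier G"
  by (simp add: carrier_G)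

lemma elt_mult: "elt c \<otimes>\<^bsub>G\<^esub> elt d = elt (coords_mult c d)"
  by (cases c rule: elt.cases; cases d rule: elt.cases)
    (simp add: G_def sym_group_def dihedral_group_def elt.simps perm3_comp mod_simps)

lemma one_elt: "\<one>\<^bsub>G\<^esub> = elt (0, False, 0, False)"
  by (simp add: G_def sym_group_def dihedral_group_def perm3_id elt.simps)

lemma card_carrier_G: "card (carrier G) = 12 * n"
proof -
  have "card (carrier (sym_group 3)) = 6"
    by (simp add: sym_group_def card_permutations[OF refl] numeral_eq_Suc)
  then show ?thesis
    using order_dihedral_group[of n]
    by (simp add: G_def order_def card_cartesian_product)
qed

sublocale involution_cayley G gen
proof (intro involution_cayley.intro involution_cayley_axioms.intro)
  show "group G" unfolding G_def by (intro DirProd_group sym_group_is_group group_dihedral_group n)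
  show "finite (carrier G)" using card_carrier_G n by (intro card_ge_0_finite) simp
  show "gen s \<in> carrier G" for s by (simp add: gen_def)
  show "gen s \<otimes>\<^bsub>G\<^esub> gen s = \<one>\<^bsub>G\<^esub>" for s
    by (cases s) (simp_all add: gen_def elt_mult one_elt)
  show "gen s \<noteq> \<one>\<^bsub>G\<^esub>" for s
    by (cases s) (simp_all add: gen_def one_elt elt_eq_iff)
  show "inj gen"
  proof (rule injI)
    fix s t assume "gen s = gen t"
    then show "s = t" by (cases s; cases t) (simp_all add: gen_def elt_eq_iff)
  qed
qed

lemma X_graph_eq: "X_graph n = cayley_graph G (range gen)"
proof -
  have "range gen = {gen La, gen Lb, gen Lc}" by (simp add: UNIV_letter)
  also have "gen La = (transpose 1 2, \<one>\<^bsub>dihedral_group n\<^esub>)"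
    by (simp add: gen_def elt.simps perm3_transpose dihedral_group_def)
  also have "gen Lb = (transpose 1 3, dih_z)"
    by (simp add: gen_def elt.simps perm3_transpose dih_z_def)
  also have "gen Lc = (transpose 2 3, dih_z \<otimes>\<^bsub>dihedral_group n\<^esub> dih_r)"
    by (simp add: gen_def elt.simps perm3_transpose dihedral_group_def dih_z_def dih_r_def)
  finally show ?thesis by (simp add: X_graph_def G_def)
qed

lemma word_elt: "word w = elt (word_coords w)"
  by (induction w) (simp_all add: one_elt flip: elt_mult gen_def)

lemma word_eq_one_iff: "word w = \<one>\<^bsub>G\<^esub> \<longleftrightarrow> trivial_coords (int n) (word_coords w)"
  by (cases "word_coords w" rule: elt.cases)
    (simp add: word_elt one_elt elt_eq_iff trivial_coords_def)

lemma elt_mult_gen: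
  "elt (j, e, i, f) \<otimes>\<^bsub>G\<^esub> gen La = elt (j, \<not> e, i, f)"
  "elt (j, e, i, f) \<otimes>\<^bsub>G\<^esub> gen Lb = elt (if e then j - 1 else j + 1, \<not> e, i, \<not> f)"
  "elt (j, e, i, f) \<otimes>\<^bsub>G\<^esub> gen Lc =
    elt (if e then j - 2 else j + 2, \<not> e, if f then i + 1 else i - 1, \<not> f)"
  by (simp_all add: gen_def elt_mult elt_eq_iff)

end

section \<open>Reduced words\<close>

text \<open>Coordinates are carried along with each word, so that evaluation needs one
  multiplication per added letter.\<close>

primrec reduced_words :: "nat \<Rightarrow> (letter list \<times> coords) list" where
  "reduced_words 0 = [([], (0, False, 0, False))]"
| "reduced_words (Suc k) = concat (map (\<lambda>(w, c).
     map (\<lambda>s. (s # w, coords_mult (letter_coords s) c))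
       (filter (\<lambda>s. w = [] \<or> s \<noteq> hd w) [La, Lb, Lc])) (reduced_words k))"

lemma set_letters: "set [La, Lb, Lc] = UNIV"
  by (simp add: UNIV_letter)

lemma bex_fst_snd: "(\<exists>x\<in>S. Q (fst x) (snd x)) \<longleftrightarrow> (\<exists>v d. (v, d) \<in> S \<and> Q v d)"
  by (metis fst_conv snd_conv surj_pair)

lemma in_reduced_words_iff:
  "(w, c) \<in> set (reduced_words k) \<longleftrightarrow> length w = k \<and> distinct_adj w \<and> c = word_coords w"
proof (induction k arbitrary: w c)
  case 0
  show ?case by auto
next
  case (Suc k)
  have "(w, c) \<in> set (reduced_words (Suc k)) \<longleftrightarrow> (\<exists>x \<in> set (reduced_words k).
      \<exists>s. (fst x = [] \<or> s \<noteq> hd (fst x)) \<and> w = s # fst x \<and> c = coords_mult (letter_coords s) (snd x))"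
    unfolding reduced_words.simps set_concat set_map image_image set_filter case_prod_unfold set_letters
    by blast
  also have "\<dots> \<longleftrightarrow> (\<exists>v d. (v, d) \<in> set (reduced_words k) \<and>
      (\<exists>s. (v = [] \<or> s \<noteq> hd v) \<and> w = s # v \<and> c = coords_mult (letter_coords s) d))"
    by (rule bex_fst_snd[of _ "\<lambda>v d. \<exists>s. (v = [] \<or> s \<noteq> hd v) \<and> w = s # v \<and>
      c = coords_mult (letter_coords s) d"])
  also have "\<dots> \<longleftrightarrow> (\<exists>s v. w = s # v \<and> length v = k \<and> distinct_adj v \<and> (v = [] \<or> s \<noteq> hd v) \<and>
      c = coords_mult (letter_coords s) (word_coords v))"
    unfolding Suc.IH by blast
  also have "\<dots> \<longleftrightarrow> length w = Suc k \<and> distinct_adj w \<and> c = word_coords w"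
  proof (cases w)
    case (Cons s v)
    then show ?thesis
      by (simp only: list.inject distinct_adj_Cons word_coords.simps list.size) force
  qed simp
  finally show ?case .
qed

lemma distinct_reduced_words: "distinct (map fst (reduced_words k))"
proof (induction k)
  case (Suc k)
  define Q :: "letter list \<times> coords \<Rightarrow> letter \<Rightarrow> bool"
    where "Q = (\<lambda>x s. fst x = [] \<or> s \<noteq> hd (fst x))"
  have *: "distinct (concat (map (\<lambda>x. map (\<lambda>s. s # fst x) (filter (Q x) ys)) xs))"
    if "distinct (map fst xs)" "distinct ys" for ys and xs :: "(letter list \<times> coords) list"
    using that by (induction xs) (auto simp: distinct_map inj_on_def rev_image_eqI)
  have "map fst (reduced_words (Suc k)) =
      concat (map (\<lambda>x. map (\<lambda>s. s # fst x) (filter (Q x) [La, Lb, Lc])) (reduced_words k))"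
    by (simp add: Q_def map_concat case_prod_unfold o_def del: filter.simps)
  moreover have "distinct \<dots>" by (rule *[OF Suc.IH]) simp
  ultimately show ?case by simp
qed simp

text \<open>Turns a cardinality into the length of a list that evaluation can compute; no word is
  listed twice.\<close>

lemma card_words:
  "card {w. length w = k \<and> distinct_adj w \<and> P (word_coords w) \<and> hd w = s} =
    length (filter (\<lambda>(w, c). P c \<and> hd w = s) (reduced_words k))"
proof -
  let ?xs = "map fst (filter (\<lambda>(w, c). P c \<and> hd w = s) (reduced_words k))"
  have "w \<in> set ?xs \<longleftrightarrow> (\<exists>c. (w, c) \<in> set (reduced_words k) \<and> P c \<and> hd w = s)" for w
  proof -
    have "w \<in> set ?xs \<longleftrightarrow> (\<exists>x\<in>set (reduced_words k). w = fst x \<and> P (snd x) \<and> hd (fst x) = s)"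
      unfolding set_map set_filter case_prod_unfold by blast
    also have "\<dots> \<longleftrightarrow> (\<exists>v c. (v, c) \<in> set (reduced_words k) \<and> w = v \<and> P c \<and> hd v = s)"
      by (rule bex_fst_snd[of _ "\<lambda>v c. w = v \<and> P c \<and> hd v = s"])
    finally show ?thesis by blast
  qed
  then have "{w. length w = k \<and> distinct_adj w \<and> P (word_coords w) \<and> hd w = s} = set ?xs"
    unfolding in_reduced_words_iff by blast
  moreover
  have "distinct ?xs"
    by (intro distinct_map_filter distinct_reduced_words)
  then have "card (set ?xs) = length ?xs" by (rule distinct_card)
  ultimately show ?thesis by (simp only: length_map)
qed

lemma all_reduced_words:
  assumes "list_all (\<lambda>(w, c). P c) (reduced_words k)" "length w = k" "distinct_adj w"
  shows "P (word_coords w)"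
proof -
  have "(w, word_coords w) \<in> set (reduced_words k)"
    using assms(2,3) unfolding in_reduced_words_iff by blast
  with assms(1) have "(\<lambda>(w, c). P c) (w, word_coords w)"
    unfolding list_all_iff by (rule bspec)
  then show ?thesis unfolding case_prod_conv .
qed

section \<open>Rainbow domination\<close>

text \<open>Double counting: an uncoloured vertex sees weight at least 3 on its neighbours, while
  the weight of each vertex is seen from three neighbours, so the uncoloured vertices number at most
  the total weight. So do the coloured ones, each having weight at least 1.\<close>

lemma rainbow_dominating3_weight_ge:
  assumes "pair_graph X" "cubic X" "rainbow_dominating3 X f"
  shows "card (pverts X) \<le> 2 * (\<Sum>v\<in>pverts X. card (f v))"
proof -
  interpret pair_graph X by fact
  let ?V = "pverts X" and ?N = "neighbourhood X" and ?w = "\<Sum>v\<in>pverts X. card (f v)"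
  define E where "E = {v \<in> ?V. f v = {}}"
  have fin: "finite ?V" by (rule pair_finite_verts)
  \<comment> \<open>Neighbours by outgoing and by incoming arcs, as the exchange of summation passes
    from one to the other.\<close>
  have N: "?N v = {u. u \<in> ?V \<and> (v, u) \<in> parcs X}" "?N v = {u. u \<in> ?V \<and> (u, v) \<in> parcs X}" for v
    by (auto simp: neighbourhood_def dest: in_arcsD2 arcs_symmetric)
  have finN: "finite (?N v)" for v unfolding N(1) using fin by simp
  have sub: "f v \<subseteq> {1, 2, 3}" if "v \<in> ?V" for v
    using assms(3) that by (auto simp: rainbow_dominating3_def)
  have "3 \<le> (\<Sum>u\<in>?N v. card (f u))" if v: "v \<in> E" for v
  proof -
    have "(\<Union>u\<in>?N v. f u) = {1, 2, 3}"
      using assms(3) v by (auto simp: rainbow_dominating3_def E_def)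
    then have "3 = card (\<Union>u\<in>?N v. f u)" by simp
    also have "\<dots> \<le> (\<Sum>u\<in>?N v. card (f u))" by (rule card_UN_le[OF finN])
    finally show ?thesis .
  qed
  then have "3 * card E \<le> (\<Sum>v\<in>E. \<Sum>u\<in>?N v. card (f u))"
    using sum_bounded_below[of E 3 "\<lambda>v. \<Sum>u\<in>?N v. card (f u)"] by (simp add: mult.commute)
  also have "\<dots> \<le> (\<Sum>v\<in>?V. \<Sum>u\<in>?N v. card (f u))"
    using fin by (intro sum_mono2) (auto simp: E_def)
  also have "\<dots> = (\<Sum>u\<in>?V. \<Sum>v\<in>?N u. card (f u))"
  proof -
    have "(\<Sum>v\<in>?V. \<Sum>u\<in>?N v. card (f u)) =
        (\<Sum>v\<in>?V. \<Sum>u | u \<in> ?V \<and> (v, u) \<in> parcs X. card (f u))" by (simp only: N(1))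
    also have "\<dots> = (\<Sum>u\<in>?V. \<Sum>v | v \<in> ?V \<and> (v, u) \<in> parcs X. card (f u))"
      by (rule sum.swap_restrict[OF fin fin])
    also have "\<dots> = (\<Sum>u\<in>?V. \<Sum>v\<in>?N u. card (f u))" by (simp only: N(2))
    finally show ?thesis .
  qed
  also have "\<dots> = 3 * ?w"
    using assms(2) by (simp add: cubic_def sum_distrib_left)
  finally have "card E \<le> ?w" by simp
  moreover have "card (?V - E) \<le> ?w"
  proof -
    have "1 \<le> card (f v)" if "v \<in> ?V - E" for v
    proof -
      have "finite (f v)" using that by (intro finite_subset[OF sub]) simp_all
      moreover have "f v \<noteq> {}" using that by (simp add: E_def)
      ultimately show ?thesis by (simp add: Suc_le_eq card_gt_0_iff)
    qed
    then have "card (?V - E) \<le> (\<Sum>v\<in>?V - E. card (f v))"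
      using sum_bounded_below[of "?V - E" 1 "\<lambda>v. card (f v)"] by simp
    also have "\<dots> \<le> ?w" using fin by (intro sum_mono2) auto
    finally show ?thesis .
  qed
  moreover have "card ?V = card E + card (?V - E)"
  proof -
    have "E \<subseteq> ?V" "finite E" using fin by (auto simp: E_def)
    then show ?thesis using card_Diff_subset[of E ?V] card_mono[OF fin, of E] by simp
  qed
  ultimately show ?thesis by simp
qed

lemma rainbow_domination_regular3I:
  assumes "pair_graph X" "cubic X" "rainbow_dominating3 X f"
    and le: "2 * (\<Sum>v\<in>pverts X. card (f v)) \<le> card (pverts X)"
  shows "rainbow_domination_regular3 X"
proof -
  let ?P = "\<lambda>w. \<exists>f. rainbow_dominating3 X f \<and> w = (\<Sum>v \<in> pverts X. card (f v))"
  have "?P (\<Sum>v\<in>pverts X. card (f v))" using assms(3) by blast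
  then have "?P (Least ?P)" "Least ?P \<le> (\<Sum>v\<in>pverts X. card (f v))"
    by (rule LeastI, rule Least_le)
  then have "card (pverts X) = 2 * Least ?P"
    using rainbow_dominating3_weight_ge[OF assms(1,2)] le by fastforce
  then show ?thesis
    using assms(2) by (simp add: rainbow_domination_regular3_def rainbow_domination_number3_def)
qed

section \<open>Short relations\<close>

text \<open>Settled by enumeration with an infinite second factor, the case of modulus 0. Lengths
  start at 1 because the empty word is trivial.\<close>

lemma no_short_relation: "list_all (\<lambda>k. list_all (\<lambda>(w, c). \<not> trivial_coords 0 c) (reduced_words k)) [1..<8]"
  by code_simp

lemma no_short_relation_3:
  "list_all (\<lambda>k. list_all (\<lambda>(w, c). \<not> trivial_coords 3 c) (reduced_words k)) [1..<6]"
  by code_simp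

text \<open>Modulus 1 ignores the exponent of \<open>r\<close>. The bound 3 on this exponent is what
  makes all \<open>n \<ge> 4\<close> behave alike.\<close>

lemma short_rotation:
  "list_all (\<lambda>k. list_all (\<lambda>(w, c). trivial_coords 1 c \<longrightarrow> \<bar>fst (snd (snd c))\<bar> \<le> 3)
     (reduced_words k)) [0..<9]"
  by code_simp

text \<open>Read from a vertex, a relation traces a cycle through the edge labelled by its first
  letter, so these counts become the signature for \<open>n \<ge> 4\<close>.\<close>

lemma count_relations:
  "length (filter (\<lambda>(w, c). trivial_coords 0 c \<and> hd w = La) (reduced_words 8)) = 6"
  "length (filter (\<lambda>(w, c). trivial_coords 0 c \<and> hd w = Lb) (reduced_words 8)) = 5"
  "length (filter (\<lambda>(w, c). trivial_coords 0 c \<and> hd w = Lc) (reduced_words 8)) = 5"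
  by code_simp+

text \<open>The words counted are \<open>(b c)^3\<close> and \<open>(c b)^3\<close>:
  \<open>b c\<close> has order 3 in both factors when \<open>n = 3\<close>.\<close>

lemma count_relations_3:
  "length (filter (\<lambda>(w, c). trivial_coords 3 c \<and> hd w = La) (reduced_words 6)) = 0"
  "length (filter (\<lambda>(w, c). trivial_coords 3 c \<and> hd w = Lb) (reduced_words 6)) = 1"
  "length (filter (\<lambda>(w, c). trivial_coords 3 c \<and> hd w = Lc) (reduced_words 6)) = 1"
  by code_simp+

text \<open>A word that is trivial modulo \<open>m\<close> is trivial up to a power of
  \<open>r\<close>, whose exponent then has absolute value at most 3; a multiple of \<open>m\<close>
  that small is 0.\<close>

lemma trivial_coords_large:
  assumes "m \<ge> 4" "length w \<le> 8" "distinct_adj w"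
  shows "trivial_coords m (word_coords w) \<longleftrightarrow> trivial_coords 0 (word_coords w)"
proof -
  obtain j e i f where c: "word_coords w = (j, e, i, f)" by (rule prod_cases4)
  have "length w \<in> set [0..<9]" using assms(2) by simp
  then have "list_all (\<lambda>(w, c). trivial_coords 1 c \<longrightarrow> \<bar>fst (snd (snd c))\<bar> \<le> 3) (reduced_words (length w))"
    using short_rotation unfolding list_all_iff by (rule bspec[rotated])
  from all_reduced_words[OF this refl assms(3)]
  have small: "trivial_coords 1 (word_coords w) \<Longrightarrow> \<bar>i\<bar> \<le> 3" by (simp add: c)
  show ?thesis
  proof
    assume t: "trivial_coords m (word_coords w)"
    then have "trivial_coords 1 (word_coords w)" by (simp add: c trivial_coords_def)
    then have "\<bar>i\<bar> < m" using small assms(1) by linarith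
    moreover have "m dvd i" using t by (simp add: c trivial_coords_def mod_eq_0_iff_dvd)
    ultimately have "i = 0" using dvd_imp_le_int[of i m] by linarith
    then show "trivial_coords 0 (word_coords w)" using t by (simp add: c trivial_coords_def)
  next
    assume "trivial_coords 0 (word_coords w)"
    then show "trivial_coords m (word_coords w)" by (simp add: c trivial_coords_def)
  qed
qed

section \<open>Girth and signature of the graphs\<close>

context X_coords
begin

abbreviation relations :: "nat \<Rightarrow> letter \<Rightarrow> letter list set" where
  "relations L s \<equiv> {w. length w = L \<and> distinct_adj w \<and> word w = \<one>\<^bsub>G\<^esub> \<and> hd w = s}"

text \<open>Relations beginning with \<open>s\<close> count the girth cycles through the edge
  labelled \<open>s\<close> at any vertex. A relation is asked for that begins with
  \<open>Lb\<close>, because for \<open>n = 3\<close> no shortest one begins with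
  \<open>La\<close>.\<close>

lemma girth_signature:
  assumes L: "3 \<le> L"
    and shorter: "\<And>v. v \<noteq> [] \<Longrightarrow> length v < L \<Longrightarrow> distinct_adj v \<Longrightarrow> word v \<noteq> \<one>\<^bsub>G\<^esub>"
    and ne: "card (relations L Lb) \<noteq> 0"
  shows "girth X = enat L"
    and "has_signature X (sort (map (\<lambda>s. card (relations L s)) [La, Lb, Lc]))"
proof -
  obtain w where w: "length w = L" "distinct_adj w" "word w = \<one>\<^bsub>G\<^esub>"
  proof -
    have "relations L Lb \<noteq> {}" using ne by (metis card.empty)
    then show thesis using that by blast
  qed
  have girth: "girth X = enat L"
  proof -
    have "girth X = enat (length w)"
    proof (rule girth_X)
      show "word v \<noteq> \<one>\<^bsub>G\<^esub>" if "v \<noteq> []" "length v < length w" "distinct_adj v" for v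
        by (rule shorter[OF that(1) _ that(3)]) (use that(2) w(1) in simp)
    qed (use L w in simp_all)
    then show ?thesis by (simp only: w(1))
  qed
  then show "girth X = enat L" .
  have "vertex_signature X g = sort (map (\<lambda>s. card (relations L s)) [La, Lb, Lc])"
    if g: "g \<in> carrier G" for g
  proof -
    let ?c = "girth_cycles_through X"
    have through: "?c {g, g \<otimes>\<^bsub>G\<^esub> gen s} = card (relations L s)" for s
      unfolding girth_cycles_through_eq[OF pair_wf_digraph_X sym_parcs_X girth]
      by (rule card_closed_paths_from[OF g L shorter])
    have "mset_set (neighbourhood X g) = image_mset (\<lambda>s. g \<otimes>\<^bsub>G\<^esub> gen s) (mset_set UNIV)"
      unfolding neighbourhood_X[OF g] using inj_mult_gen[OF g] by (rule image_mset_mset_set[symmetric])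
    also have "mset_set UNIV = mset [La, Lb, Lc]" by (simp add: UNIV_letter)
    finally have "image_mset (\<lambda>u. ?c {g, u}) (mset_set (neighbourhood X g)) =
        mset (map (\<lambda>s. card (relations L s)) [La, Lb, Lc])"
      by (simp only: image_mset.compositionality o_def through mset_map)
    then show ?thesis by (simp only: vertex_signature_def sorted_list_of_multiset_mset)
  qed
  then show "has_signature X (sort (map (\<lambda>s. card (relations L s)) [La, Lb, Lc]))"
    unfolding has_signature_def using one_closed by auto
qed

lemma card_relations:
  "card (relations L s) =
    length (filter (\<lambda>(w, c). trivial_coords (int n) c \<and> hd w = s) (reduced_words L))"
  unfolding word_eq_one_iff by (rule card_words)

lemma girth_signature_3:
  assumes "n = 3"
  shows "girth X = 6" "has_signature X [0, 1, 1]"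
proof -
  have shorter: "word v \<noteq> \<one>\<^bsub>G\<^esub>" if "v \<noteq> []" "length v < 6" "distinct_adj v" for v
  proof -
    have "length v \<in> set [1..<6]" using that by (cases v) auto
    then have "list_all (\<lambda>(w, c). \<not> trivial_coords 3 c) (reduced_words (length v))"
      using no_short_relation_3 unfolding list_all_iff by (rule bspec[rotated])
    from all_reduced_words[OF this refl that(3)] show ?thesis
      unfolding word_eq_one_iff by (simp add: assms)
  qed
  have n3: "int n = 3" using assms by simp
  have card: "card (relations 6 La) = 0" "card (relations 6 Lb) = 1" "card (relations 6 Lc) = 1"
    by (simp_all only: card_relations n3 count_relations_3)
  have ne: "(3::nat) \<le> 6" "card (relations 6 Lb) \<noteq> 0" unfolding card by simp_all
  have "girth X = enat 6" by (rule girth_signature(1)[OF ne(1) _ ne(2)]) (rule shorter)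
  then show "girth X = 6" by (simp only: numeral_eq_enat)
  have "has_signature X (sort (map (\<lambda>s. card (relations 6 s)) [La, Lb, Lc]))"
    by (rule girth_signature(2)[OF ne(1) _ ne(2)]) (rule shorter)
  then show "has_signature X [0, 1, 1]" unfolding list.map card by simp
qed

lemma shorter_8:
  assumes "n \<ge> 4" "v \<noteq> []" "length v < 8" "distinct_adj v"
  shows "word v \<noteq> \<one>\<^bsub>G\<^esub>"
proof -
  have "length v \<in> set [1..<8]" using assms by (cases v) auto
  then have "list_all (\<lambda>(w, c). \<not> trivial_coords 0 c) (reduced_words (length v))"
    using no_short_relation unfolding list_all_iff by (rule bspec[rotated])
  from all_reduced_words[OF this refl assms(4)] show ?thesis
    using trivial_coords_large[of "int n" v] assms by (simp add: word_eq_one_iff)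
qed

lemma card_relations_8:
  assumes "n \<ge> 4"
  shows "card (relations 8 s) = (case s of La \<Rightarrow> 6 | _ \<Rightarrow> 5)"
proof -
  have "word w = \<one>\<^bsub>G\<^esub> \<longleftrightarrow> trivial_coords 0 (word_coords w)" if "length w = 8" "distinct_adj w" for w
    unfolding word_eq_one_iff by (rule trivial_coords_large) (use assms that in simp_all)
  then have "relations 8 s =
      {w. length w = 8 \<and> distinct_adj w \<and> trivial_coords 0 (word_coords w) \<and> hd w = s}"
    by blast
  then have "card (relations 8 s) =
      length (filter (\<lambda>(w, c). trivial_coords 0 c \<and> hd w = s) (reduced_words 8))"
    by (simp only: card_words)
  then show ?thesis by (cases s) (simp_all only: count_relations letter.case)
qed

lemma girth_signature_8:
  assumes "n \<ge> 4"
  shows "girth X = 8" "has_signature X [5, 5, 6]"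
proof -
  have ne: "(3::nat) \<le> 8" "card (relations 8 Lb) \<noteq> 0"
    unfolding card_relations_8[OF assms] by simp_all
  have "girth X = enat 8" by (rule girth_signature(1)[OF ne(1) _ ne(2)]) (rule shorter_8[OF assms])
  then show "girth X = 8" by (simp only: numeral_eq_enat)
  have "has_signature X (sort (map (\<lambda>s. card (relations 8 s)) [La, Lb, Lc]))"
    by (rule girth_signature(2)[OF ne(1) _ ne(2)]) (rule shorter_8[OF assms])
  then show "has_signature X [5, 5, 6]"
    unfolding list.map card_relations_8[OF assms] letter.case by simp
qed

section \<open>Generation of the group by the three involutions\<close>

lemma word_surj:
  assumes "g \<in> carrier G"
  shows "\<exists>w. g = word w"
proof -
  have mult: "elt (coords_mult c d) \<in> range word" if "elt c \<in> range word" "elt d \<in> range word" for c d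
  proof -
    from that obtain u v where "elt c = word u" "elt d = word v" by blast
    then have "elt (coords_mult c d) = word (u @ v)" by (simp only: word_append flip: elt_mult)
    then show ?thesis by (rule range_eqI)
  qed
  have lets: "elt (letter_coords s) \<in> range word" for s
    by (rule range_eqI[of _ _ "[s]"]) (simp flip: gen_def)
  have one: "elt (0, False, 0, False) \<in> range word"
    by (rule range_eqI[of _ _ "[]"]) (simp add: one_elt)
  have a: "elt (0, True, 0, False) \<in> range word" using lets[of La] by simp
  have b: "elt (1, True, 0, True) \<in> range word" using lets[of Lb] by simp
  \<comment> \<open>\<open>b a b\<close> is a transposition with trivial component in
    \<open>D_n\<close>; its product with \<open>a\<close> is a 3-cycle with the same
    property.\<close>
  have "elt (2, True, 0, False) \<in> range word" using mult[OF mult[OF b a] b] by simp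
  from mult[OF a this] have "elt (-2, False, 0, False) \<in> range word" by simp
  moreover have "elt (-2, False, 0, False) = elt (1, False, 0, False)" by (simp add: elt_eq_iff)
  ultimately have w: "elt (1, False, 0, False) \<in> range word" by simp
  \<comment> \<open>\<open>b c\<close> has component \<open>r\<close> in \<open>D_n\<close>, and the
    3-cycle found above removes its component in \<open>S_3\<close>.\<close>
  have "elt (-1, False, 1, False) \<in> range word" using mult[OF b lets[of Lc]] by simp
  from mult[OF w this] have r: "elt (0, False, 1, False) \<in> range word" by simp
  from mult[OF w a] have "elt (1, True, 0, False) \<in> range word" by simp
  \<comment> \<open>Likewise \<open>b\<close> is freed of its transposition, which leaves
    \<open>z\<close>.\<close>
  from mult[OF this b] have z: "elt (0, False, 0, True) \<in> range word" by simp
  have ws: "elt (int k, False, 0, False) \<in> range word" for k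
  proof (induction k)
    case (Suc k)
    from mult[OF this w] show ?case by (simp add: add.commute)
  qed (simp add: one)
  have rs: "elt (0, False, int k, False) \<in> range word" for k
  proof (induction k)
    case (Suc k)
    from mult[OF this r] show ?case by (simp add: add.commute)
  qed (simp add: one)
  obtain j e i f where g: "g = elt (j, e, i, f)"
    using assms unfolding carrier_G by (metis imageE prod_cases4)
  have "elt (j, False, 0, False) \<in> range word"
  proof -
    have "elt (j, False, 0, False) = elt (int (nat (j mod 3)), False, 0, False)"
      by (simp add: elt_eq_iff)
    then show ?thesis using ws by metis
  qed
  moreover have "elt (0, False, i, False) \<in> range word"
  proof -
    have "elt (0, False, i, False) = elt (0, False, int (nat (i mod int n)), False)"
      using n by (simp add: elt_eq_iff)
    then show ?thesis using rs by metis
  qed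
  ultimately have "elt (coords_mult (j, False, 0, False) (0, False, i, False)) \<in> range word"
    by (rule mult)
  then have "elt (j, False, i, False) \<in> range word" by simp
  moreover have "elt (0, e, 0, f) \<in> range word"
    using one a z mult[OF a z] by (cases e; cases f) simp_all
  ultimately have "elt (coords_mult (j, False, i, False) (0, e, 0, f)) \<in> range word" by (rule mult)
  then show ?thesis unfolding g by auto
qed

section \<open>Rainbow domination of the graphs\<close>

lemma cubic_X: "cubic X"
  by (simp add: cubic_def card_neighbourhood_X card_letter)

lemma fst_mult: "fst (g \<otimes>\<^bsub>G\<^esub> h) = fst g \<circ> fst h"
  by (cases g; cases h) (simp add: G_def sym_group_def)

lemma rainbow_domination_regular3_X: "rainbow_domination_regular3 X"
proof -
  \<comment> \<open>The elements with even permutation, indexed by representatives so that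
    \<open>R\<close> visibly has at most \<open>6 * n\<close> elements.\<close>
  define R where "R = (\<lambda>(j, i, f). elt (j, False, i, f)) ` ({0..<3} \<times> {0..<int n} \<times> UNIV)"
  have R: "elt (j, False, i, f) \<in> R" for j i f
  proof -
    have "elt (j, False, i, f) = elt (j mod 3, False, i mod int n, f)" by (simp add: elt_eq_iff)
    then show ?thesis using n unfolding R_def by (intro image_eqI[of _ _ "(j mod 3, i mod int n, f)"]) auto
  qed
  define f where "f g = (if g \<in> R then {fst g 1} else {})" for g
  have fst: "fst g permutes {1..3}" if "g \<in> carrier G" for g
    using that by (auto simp: G_def sym_group_def)
  have gen_1: "fst (gen La) 1 = 2" "fst (gen Lb) 1 = 3" "fst (gen Lc) 1 = 1"
    by (simp_all add: gen_def elt.simps perm3_transpose transpose_def)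
  have 3: "{1..3} = {1, 2, 3::nat}" by auto
  have "rainbow_dominating3 X f"
    unfolding rainbow_dominating3_def
  proof (intro conjI ballI impI)
    show "f v \<subseteq> {1, 2, 3}" if "v \<in> pverts X" for v
      using permutes_in_image[OF fst[of v], of 1] that unfolding 3 by (auto simp: f_def)
  next
    fix v assume v: "v \<in> pverts X" "f v = {}"
    then have vc: "v \<in> carrier G" by simp
    obtain j e i b where c: "v = elt (j, e, i, b)"
      using vc unfolding carrier_G by (metis imageE prod_cases4)
    \<comment> \<open>An element without colour lies outside \<open>R\<close>, so its permutation is
      odd and all its neighbours lie in \<open>R\<close>.\<close>
    have "e" using v(2) R[of j i b] by (cases e) (simp_all add: f_def c)
    then have "v \<otimes>\<^bsub>G\<^esub> gen s \<in> R" for s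
      using R by (cases s) (simp_all add: c elt_mult_gen)
    then have "f (v \<otimes>\<^bsub>G\<^esub> gen s) = {(fst v \<circ> fst (gen s)) 1}" for s
      by (simp only: f_def if_True fst_mult)
    then have "(\<Union>u\<in>neighbourhood X v. f u) = (\<lambda>s. (fst v \<circ> fst (gen s)) 1) ` UNIV"
      unfolding neighbourhood_X[OF vc] by auto
    also have "\<dots> = {fst v 2, fst v 3, fst v 1}"
      by (simp only: UNIV_letter image_insert image_empty o_apply gen_1)
    also have "\<dots> = fst v ` {1, 2, 3}" by auto
    also have "\<dots> = {1, 2, 3}" using permutes_image[OF fst[OF vc]] unfolding 3 .
    finally show "(\<Union>u\<in>neighbourhood X v. f u) = {1, 2, 3}" .
  qed
  moreover have "2 * (\<Sum>v\<in>pverts X. card (f v)) \<le> card (pverts X)"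
  proof -
    have "finite R" by (simp add: R_def)
    have "(\<Sum>v\<in>pverts X. card (f v)) = (\<Sum>v\<in>carrier G. if v \<in> R then 1 else 0)"
      unfolding pverts_X by (intro sum.cong) (auto simp: f_def)
    also have "\<dots> = card (carrier G \<inter> R)"
      using finite_carrier by (simp add: sum.If_cases)
    also have "\<dots> \<le> card R" using \<open>finite R\<close> by (intro card_mono) auto
    also have "\<dots> \<le> card ({0..<3::int} \<times> {0..<int n} \<times> (UNIV :: bool set))"
      unfolding R_def by (intro card_image_le) simp
    also have "\<dots> = 6 * n" by (simp add: card_cartesian_product)
    finally show ?thesis by (simp add: card_carrier_G)
  qed
  ultimately show ?thesis by (intro rainbow_domination_regular3I pair_graph_X cubic_X)
qed

end

section \<open>Generalized Petersen graphs\<close>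

text \<open>Each listed edge gets one orientation; the converse relation supplies the other.\<close>

definition petersen_arcs :: "nat \<Rightarrow> nat \<Rightarrow> petersen_vertex rel" where
  "petersen_arcs m k = (\<lambda>i. (Outer i, Outer ((i + 1) mod m))) ` {..<m} \<union>
     (\<lambda>i. (Outer i, Inner i)) ` {..<m} \<union> (\<lambda>i. (Inner i, Inner ((i + k) mod m))) ` {..<m}"

lemma pverts_gen_petersen: "pverts (gen_petersen m k) = Outer ` {0..<m} \<union> Inner ` {0..<m}"
  by (simp add: gen_petersen_def graph_of_edges_def)

lemma parcs_gen_petersen: "parcs (gen_petersen m k) = petersen_arcs m k \<union> (petersen_arcs m k)\<inverse>"
proof -
  have "{u, v} = {a, b} \<longleftrightarrow> (u, v) = (a, b) \<or> (v, u) = (a, b)" for u v a b :: petersen_vertex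
    by (auto simp: doubleton_eq_iff)
  then have "(u, v) \<in> parcs (gen_petersen m k) \<longleftrightarrow>
      (u, v) \<in> petersen_arcs m k \<or> (v, u) \<in> petersen_arcs m k" for u v
    unfolding gen_petersen_def graph_of_edges_def petersen_arcs_def by (simp add: image_iff) blast
  then show ?thesis by auto
qed

lemma card_pverts_gen_petersen: "card (pverts (gen_petersen m k)) = 2 * m"
  unfolding pverts_gen_petersen by (subst card_Un_disjoint) (auto simp: card_image inj_on_def)

lemma finite_parcs_gen_petersen: "finite (parcs (gen_petersen m k))"
  by (simp add: parcs_gen_petersen petersen_arcs_def)

text \<open>Merely a bound, since listed edges may coincide, as the inner ones do for
  \<open>2 * k = m\<close>.\<close>

lemma card_parcs_gen_petersen: "card (parcs (gen_petersen m k)) \<le> 6 * m"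
proof -
  have im: "card (f ` {..<m}) \<le> m" for f :: "nat \<Rightarrow> petersen_vertex \<times> petersen_vertex"
    using card_image_le[of "{..<m}" f] by simp
  have "card (petersen_arcs m k) \<le> 3 * m"
    unfolding petersen_arcs_def
    by (rule order.trans[OF card_Un_le] order.trans[OF add_mono[OF card_Un_le im]])+
      (rule order.trans[OF add_mono[OF add_mono[OF im im] le_refl]]; simp)
  moreover have "card (parcs (gen_petersen m k)) \<le> card (petersen_arcs m k) + card ((petersen_arcs m k)\<inverse>)"
    unfolding parcs_gen_petersen by (rule card_Un_le)
  ultimately show ?thesis by (simp add: card_inverse)
qed

lemma parcs_gen_petersen_subset: "parcs (gen_petersen m k) \<subseteq> pverts (gen_petersen m k) \<times> pverts (gen_petersen m k)"
  by (auto simp: parcs_gen_petersen petersen_arcs_def pverts_gen_petersen)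

text \<open>For a bijection given from \<open>Y\<close> to \<open>X\<close> it is enough to lift the
  arcs of \<open>X\<close>: as \<open>Y\<close> has no more arcs than \<open>X\<close>, the
  inclusion of arc sets is an equality.\<close>

lemma digraph_isoI_of_inverse:
  assumes wf: "pair_wf_digraph X" and inj: "inj_on f (pverts Y)" and verts: "f ` pverts Y = pverts X"
    and arcs: "parcs X \<subseteq> map_prod f f ` parcs Y" and Y: "parcs Y \<subseteq> pverts Y \<times> pverts Y"
    and card: "finite (parcs Y)" "card (parcs Y) \<le> card (parcs X)"
  shows "digraph_iso (with_proj X) (with_proj Y)"
proof -
  let ?g = "the_inv_into (pverts Y) f"
  have "parcs X = map_prod f f ` parcs Y"
    using arcs card card_image_le[OF card(1), of "map_prod f f"]
    by (intro card_seteq) auto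
  then have "map_prod ?g ?g ` parcs X = (\<lambda>e. map_prod ?g ?g (map_prod f f e)) ` parcs Y"
    by (simp add: image_image)
  also have "\<dots> = (\<lambda>e. e) ` parcs Y"
    using Y by (intro image_cong refl) (auto simp: the_inv_into_f_f[OF inj])
  finally have "parcs Y = map_prod ?g ?g ` parcs X" by simp
  moreover have "inj_on ?g (pverts X)" "pverts Y = ?g ` pverts X"
    using inj_on_the_inv_into[OF inj] the_inv_into_onto[OF inj] unfolding verts by auto
  ultimately show ?thesis
    using pair_iso[OF wf, of ?g Y] unfolding digraph_iso_def by metis
qed

lemma (in involution_cayley) card_parcs_X: "card (parcs X) = card (carrier G) * card (UNIV :: 's set)"
proof -
  have "parcs X = (\<lambda>(g, s). (g, g \<otimes> gen s)) ` (carrier G \<times> UNIV)"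
  proof (intro equalityI subsetI)
    fix e assume "e \<in> parcs X"
    then obtain g s where "e = (g, g \<otimes> gen s)" "g \<in> carrier G"
      by (cases e) (auto simp: parcs_X_iff)
    then show "e \<in> (\<lambda>(g, s). (g, g \<otimes> gen s)) ` (carrier G \<times> UNIV)"
      by (intro image_eqI[of _ _ "(g, s)"]) simp_all
  qed (auto simp: parcs_X_iff)
  moreover have "inj_on (\<lambda>(g, s). (g, g \<otimes> gen s)) (carrier G \<times> UNIV)"
    using inj_gen by (auto simp: inj_on_def dest: injD)
  ultimately show ?thesis by (simp add: card_image card_cartesian_product)
qed

section \<open>The isomorphism when 3 does not divide \<open>n\<close>\<close>

context X_coords
begin

text \<open>The multiples of 3 and of \<open>n\<close> are supplied as witnesses \<open>a\<close>
  and \<open>b\<close>, which avoids reasoning with \<open>mod\<close>.\<close>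

lemma elt_eqI: "j = j' + 3 * a \<Longrightarrow> i = i' + int n * b \<Longrightarrow> elt (j, e, i, f) = elt (j', e, i', f)"
  by (simp add: elt_eq_iff)

text \<open>\<open>outer\<close> runs through the alternating products of \<open>b\<close> and \<open>c\<close>, which form a cycle of length
  \<open>6 n\<close> if \<open>3\<close> does not divide \<open>n\<close>; \<open>inner\<close> is its translate by \<open>a\<close>.\<close>

definition outer :: "int \<Rightarrow> (nat \<Rightarrow> nat) \<times> (int \<times> bool)" where
  "outer i = (if even i then elt (- (i div 2), False, i div 2, False)
     else elt (1 - i div 2, True, i div 2, True))"

definition inner :: "int \<Rightarrow> (nat \<Rightarrow> nat) \<times> (int \<times> bool)" where
  "inner i = (if even i then elt (- (i div 2), True, i div 2, False)
     else elt (1 - i div 2, False, i div 2, True))"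

lemma outer_simps:
  "outer (2 * h) = elt (- h, False, h, False)" "outer (2 * h + 1) = elt (1 - h, True, h, True)"
  by (simp_all add: outer_def)

lemma inner_simps:
  "inner (2 * h) = elt (- h, True, h, False)" "inner (2 * h + 1) = elt (1 - h, False, h, True)"
  by (simp_all add: inner_def)

lemma int_parity_cases: obtains h :: int where "i = 2 * h" | h where "i = 2 * h + 1"
  by (metis evenE oddE)

lemma outer_mult_a: "outer i \<otimes>\<^bsub>G\<^esub> gen La = inner i"
  by (cases i rule: int_parity_cases) (simp_all only: outer_simps inner_simps elt_mult_gen simp_thms)

lemma inner_mult_a: "inner i \<otimes>\<^bsub>G\<^esub> gen La = outer i"
  by (cases i rule: int_parity_cases) (simp_all only: outer_simps inner_simps elt_mult_gen simp_thms)

text \<open>From an even index \<open>b\<close> leads forward and \<open>c\<close> back; from an odd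
  index it is the other way round.\<close>

lemma outer_mult:
  assumes "s \<noteq> La"
  shows "outer i \<otimes>\<^bsub>G\<^esub> gen s \<in> {outer (i + 1), outer (i - 1)}"
proof (cases i rule: int_parity_cases)
  case (1 h)
  have "i + 1 = 2 * h + 1" "i - 1 = 2 * (h - 1) + 1" using 1 by auto
  then show ?thesis using assms 1 by (cases s) (simp_all only: outer_simps elt_mult_gen, simp_all)
next
  case (2 h)
  have "i + 1 = 2 * (h + 1)" "i - 1 = 2 * h" using 2 by auto
  moreover have "1 - h - 2 = - (h + 1)" by simp
  ultimately show ?thesis using assms 2 by (cases s) (simp_all only: outer_simps elt_mult_gen, simp_all)
qed

text \<open>Neighbours are located by the Chinese remainder theorem. For instance, \<open>b\<close>
  leads from \<open>inner (2 * h)\<close> to \<open>inner (2 * h' + 1)\<close> where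
  \<open>h'\<close> is congruent to \<open>h\<close> modulo \<open>n\<close> and to
  \<open>h - 1\<close> modulo 3; as \<open>n\<close> is 1 modulo 3, \<open>h' = h - n\<close> will
  do.\<close>

lemma inner_mult_1:
  assumes "s \<noteq> La" and c: "int n = 3 * c + 1" and k: "k = 2 * int n - 1"
  shows "inner i \<otimes>\<^bsub>G\<^esub> gen s \<in> {inner (i + k), inner (i - k)}"
proof (cases i rule: int_parity_cases)
  case (1 h)
  have "i + k = 2 * (h + int n - 1) + 1" "i - k = 2 * (h - int n) + 1" using 1 k by auto
  moreover have "elt (- h - 1, False, h, True) = elt (1 - (h - int n), False, h - int n, True)"
    by (rule elt_eqI[of _ _ "- c - 1" _ _ 1]) (simp_all add: c)
  moreover have "elt (- h - 2, False, h - 1, True) =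
      elt (1 - (h + int n - 1), False, h + int n - 1, True)"
    by (rule elt_eqI[of _ _ "c - 1" _ _ "- 1"]) (simp_all add: c)
  ultimately show ?thesis
    using assms(1) 1 by (cases s) (simp_all only: inner_simps elt_mult_gen, simp_all)
next
  case (2 h)
  have "i + k = 2 * (h + int n)" "i - k = 2 * (h - int n + 1)" using 2 k by auto
  moreover have "elt (1 - h + 1, True, h, False) = elt (- (h + int n), True, h + int n, False)"
    by (rule elt_eqI[of _ _ "c + 1" _ _ "- 1"]) (simp_all add: c)
  moreover have "elt (1 - h + 2, True, h + 1, False) =
      elt (- (h - int n + 1), True, h - int n + 1, False)"
    by (rule elt_eqI[of _ _ "1 - c" _ _ 1]) (simp_all add: c)
  ultimately show ?thesis
    using assms(1) 2 by (cases s) (simp_all only: inner_simps elt_mult_gen, simp_all)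
qed

text \<open>Here \<open>n\<close> is -1 modulo 3, so that the shift changes sign: in the same
  instance \<open>h' = h + n\<close> will do.\<close>

lemma inner_mult_2:
  assumes "s \<noteq> La" and c: "int n = 3 * c - 1" and k: "k = 2 * int n + 1"
  shows "inner i \<otimes>\<^bsub>G\<^esub> gen s \<in> {inner (i + k), inner (i - k)}"
proof (cases i rule: int_parity_cases)
  case (1 h)
  have "i + k = 2 * (h + int n) + 1" "i - k = 2 * (h - int n - 1) + 1" using 1 k by auto
  moreover have "elt (- h - 1, False, h, True) = elt (1 - (h + int n), False, h + int n, True)"
    by (rule elt_eqI[of _ _ "c - 1" _ _ "- 1"]) (simp_all add: c)
  moreover have "elt (- h - 2, False, h - 1, True) =
      elt (1 - (h - int n - 1), False, h - int n - 1, True)"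
    by (rule elt_eqI[of _ _ "- c - 1" _ _ 1]) (simp_all add: c)
  ultimately show ?thesis
    using assms(1) 1 by (cases s) (simp_all only: inner_simps elt_mult_gen, simp_all)
next
  case (2 h)
  have "i + k = 2 * (h + int n + 1)" "i - k = 2 * (h - int n)" using 2 k by auto
  moreover have "elt (1 - h + 1, True, h, False) = elt (- (h - int n), True, h - int n, False)"
    by (rule elt_eqI[of _ _ "1 - c" _ _ 1]) (simp_all add: c)
  moreover have "elt (1 - h + 2, True, h + 1, False) =
      elt (- (h + int n + 1), True, h + int n + 1, False)"
    by (rule elt_eqI[of _ _ "c + 1" _ _ "- 1"]) (simp_all add: c)
  ultimately show ?thesis
    using assms(1) 2 by (cases s) (simp_all only: inner_simps elt_mult_gen, simp_all)
qed

text \<open>A shift by \<open>6 * n\<close> moves the half index by \<open>3 * n\<close>, which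
  vanishes modulo 3 and modulo \<open>n\<close>.\<close>

lemma periodic: "outer (i + 6 * int n * q) = outer i" "inner (i + 6 * int n * q) = inner i"
proof -
  have "outer (i + 6 * int n * q) = outer i \<and> inner (i + 6 * int n * q) = inner i"
  proof (cases i rule: int_parity_cases)
    case (1 h)
    have "i + 6 * int n * q = 2 * (h + 3 * int n * q)" using 1 by simp
    then show ?thesis unfolding 1
      by (simp only: outer_simps inner_simps) (auto intro!: elt_eqI[of _ _ "- int n * q" _ _ "3 * q"])
  next
    case (2 h)
    have "i + 6 * int n * q = 2 * (h + 3 * int n * q) + 1" using 2 by simp
    then show ?thesis unfolding 2
      by (simp only: outer_simps inner_simps) (auto intro!: elt_eqI[of _ _ "- int n * q" _ _ "3 * q"])
  qed
  then show "outer (i + 6 * int n * q) = outer i" "inner (i + 6 * int n * q) = inner i" by auto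
qed

lemma periodic_mod: "outer (i mod (6 * int n)) = outer i" "inner (i mod (6 * int n)) = inner i"
  using periodic[of "i mod (6 * int n)" "i div (6 * int n)"] by simp_all

text \<open>Serves the injectivity of \<open>outer\<close> and \<open>inner\<close>:
  \<open>i\<close> and \<open>i'\<close> are half indices, and the congruences modulo 3 and
  \<open>n\<close> combine by coprimality.\<close>

lemma dvd_of_coords_cong:
  assumes "coprime 3 (int n)" "j mod 3 = j' mod 3" "i mod int n = i' mod int n"
    and "j - j' = - (i - i')"
  shows "6 * int n dvd 2 * i - 2 * i'"
proof -
  have "3 dvd - (i - i')" using assms(2,4) by (metis mod_eq_dvd_iff)
  then have "3 dvd i - i'" by (simp only: dvd_minus_iff)
  moreover have "int n dvd i - i'" using assms(3) by (simp only: mod_eq_dvd_iff)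
  ultimately have "3 * int n dvd i - i'" using assms(1) by (rule divides_mult)
  then have "2 * (3 * int n) dvd 2 * (i - i')" by (rule mult_dvd_mono[OF dvd_refl])
  then show ?thesis by (simp add: algebra_simps)
qed

text \<open>The two reflection flags agree on outer vertices and differ on inner ones, and the
  second flag shows the parity of the index.\<close>

lemma outer_inner_inj:
  assumes "coprime 3 (int n)"
  shows "outer i = outer i' \<Longrightarrow> 6 * int n dvd i - i'" "inner i = inner i' \<Longrightarrow> 6 * int n dvd i - i'"
    "outer i \<noteq> inner i'"
proof -
  have *: "(outer i = outer i' \<longrightarrow> 6 * int n dvd i - i') \<and> (inner i = inner i' \<longrightarrow> 6 * int n dvd i - i') \<and>
    outer i \<noteq> inner i'"
  proof (cases i rule: int_parity_cases; cases i' rule: int_parity_cases)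
    fix h h' assume "i = 2 * h" "i' = 2 * h'"
    then show ?thesis using dvd_of_coords_cong[OF assms, of "- h" "- h'" h h']
      by (simp only: outer_simps inner_simps elt_eq_iff) simp
  next
    fix h h' assume "i = 2 * h + 1" "i' = 2 * h' + 1"
    then show ?thesis using dvd_of_coords_cong[OF assms, of "1 - h" "1 - h'" h h']
      by (simp only: outer_simps inner_simps elt_eq_iff) simp
  next
    fix h h' assume "i = 2 * h" "i' = 2 * h' + 1"
    then show ?thesis by (simp only: outer_simps inner_simps elt_eq_iff) simp
  next
    fix h h' assume "i = 2 * h + 1" "i' = 2 * h'"
    then show ?thesis by (simp only: outer_simps inner_simps elt_eq_iff) simp
  qed
  then show "outer i = outer i' \<Longrightarrow> 6 * int n dvd i - i'" "inner i = inner i' \<Longrightarrow> 6 * int n dvd i - i'"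
    "outer i \<noteq> inner i'" by blast+
qed

primrec of_petersen :: "petersen_vertex \<Rightarrow> (nat \<Rightarrow> nat) \<times> (int \<times> bool)" where
  "of_petersen (Outer i) = outer (int i)"
| "of_petersen (Inner i) = inner (int i)"

lemma outer_closed: "outer i \<in> carrier G" and inner_closed: "inner i \<in> carrier G"
  by (simp_all add: outer_def inner_def)

lemma digraph_iso_gen_petersen:
  assumes coprime: "coprime 3 (int n)"
    and inner_mult: "\<And>s i. s \<noteq> La \<Longrightarrow> inner i \<otimes>\<^bsub>G\<^esub> gen s \<in> {inner (i + int k), inner (i - int k)}"
  shows "digraph_iso (with_proj X) (with_proj (gen_petersen (6 * n) k))"
proof (rule digraph_isoI_of_inverse[of _ of_petersen])
  let ?Y = "gen_petersen (6 * n) k"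
  show inj: "inj_on of_petersen (pverts ?Y)"
  proof (rule inj_onI)
    have eq: "a = b" if "a < 6 * n" "b < 6 * n" "6 * int n dvd int a - int b" for a b
    proof -
      have "int a mod (6 * int n) = int b mod (6 * int n)" using that(3) by (simp only: mod_eq_dvd_iff)
      then show ?thesis using that by simp
    qed
    fix x y assume "x \<in> pverts ?Y" "y \<in> pverts ?Y" "of_petersen x = of_petersen y"
    then show "x = y"
      using outer_inner_inj[OF coprime] eq unfolding pverts_gen_petersen
      by (cases x; cases y) (auto dest: outer_inner_inj(3)[OF coprime, THEN notE, OF sym])
  qed
  show verts: "of_petersen ` pverts ?Y = pverts X"
  proof (rule card_subset_eq)
    show "finite (pverts X)" by (simp add: finite_carrier)
    show "of_petersen ` pverts ?Y \<subseteq> pverts X"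
      using outer_closed inner_closed by (auto simp: pverts_gen_petersen)
    show "card (of_petersen ` pverts ?Y) = card (pverts X)"
      by (simp add: card_image[OF inj] card_pverts_gen_petersen card_carrier_G)
  qed
  \<comment> \<open>Vertices indexed by all integers, so that \<open>i - 1\<close> and
    \<open>i - k\<close> can be used without truncation or wrapping.\<close>
  define ov where "ov i = Outer (nat (i mod (6 * int n)))" for i
  define iv where "iv i = Inner (nat (i mod (6 * int n)))" for i
  have of: "of_petersen (ov i) = outer i" "of_petersen (iv i) = inner i" for i
    using n by (simp_all add: ov_def iv_def periodic_mod)
  have step: "(ov i, ov (i + 1)) \<in> petersen_arcs (6 * n) k"
    "(iv i, iv (i + int k)) \<in> petersen_arcs (6 * n) k" "(ov i, iv i) \<in> petersen_arcs (6 * n) k" for i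
  proof -
    let ?a = "nat (i mod (6 * int n))"
    have a: "?a < 6 * n" "int ?a = i mod (6 * int n)"
      using n pos_mod_bound[of "6 * int n" i] by (simp_all add: nat_less_iff)
    have "(i + int l) mod (6 * int n) = int ((?a + l) mod (6 * n))" for l
    proof -
      have "(i + int l) mod (6 * int n) = (i mod (6 * int n) + int l) mod (6 * int n)"
        by (simp only: mod_add_left_eq)
      then show ?thesis by (simp only: zmod_int of_nat_add of_nat_mult of_nat_numeral a(2))
    qed
    then have "nat ((i + int l) mod (6 * int n)) = (?a + l) mod (6 * n)" for l by simp
    from this[of k] this[of 1] a(1)
    show "(ov i, ov (i + 1)) \<in> petersen_arcs (6 * n) k"
      "(iv i, iv (i + int k)) \<in> petersen_arcs (6 * n) k" "(ov i, iv i) \<in> petersen_arcs (6 * n) k"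
      unfolding petersen_arcs_def ov_def iv_def by auto
  qed
  have arcs: "(ov i, ov (i + 1)) \<in> parcs ?Y" "(ov i, ov (i - 1)) \<in> parcs ?Y"
    "(iv i, iv (i + int k)) \<in> parcs ?Y" "(iv i, iv (i - int k)) \<in> parcs ?Y"
    "(ov i, iv i) \<in> parcs ?Y" "(iv i, ov i) \<in> parcs ?Y" for i
    using step[of i] step(1)[of "i - 1"] step(2)[of "i - int k"] by (simp_all add: parcs_gen_petersen)
  show "parcs X \<subseteq> map_prod of_petersen of_petersen ` parcs ?Y"
  proof
    fix e assume "e \<in> parcs X"
    then obtain g s where e: "e = (g, g \<otimes>\<^bsub>G\<^esub> gen s)" and g: "g \<in> carrier G"
      by (cases e) (auto simp: parcs_X_iff)
    from g verts obtain x where x: "g = of_petersen x" by auto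
    have img: "(of_petersen y, of_petersen z) \<in> map_prod of_petersen of_petersen ` parcs ?Y"
      if "(y, z) \<in> parcs ?Y" for y z using that by (metis map_prod_imageI)
    show "e \<in> map_prod of_petersen of_petersen ` parcs ?Y"
    proof (cases x)
      case (Outer i)
      have "g \<otimes>\<^bsub>G\<^esub> gen s \<in> {outer (int i + 1), outer (int i - 1), inner (int i)}"
        using outer_mult[of s "int i"] outer_mult_a[of "int i"] x Outer by (cases "s = La") auto
      moreover have "(g, y) \<in> map_prod of_petersen of_petersen ` parcs ?Y"
        if "y \<in> {outer (int i + 1), outer (int i - 1), inner (int i)}" for y
        using that img[OF arcs(1)[of "int i"]] img[OF arcs(2)[of "int i"]] img[OF arcs(5)[of "int i"]]
        unfolding of x Outer of_petersen.simps by blast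
      ultimately show ?thesis unfolding e by blast
    next
      case (Inner i)
      have "g \<otimes>\<^bsub>G\<^esub> gen s \<in> {inner (int i + int k), inner (int i - int k), outer (int i)}"
        using inner_mult[of s "int i"] inner_mult_a[of "int i"] x Inner by (cases "s = La") auto
      moreover have "(g, y) \<in> map_prod of_petersen of_petersen ` parcs ?Y"
        if "y \<in> {inner (int i + int k), inner (int i - int k), outer (int i)}" for y
        using that img[OF arcs(3)[of "int i"]] img[OF arcs(4)[of "int i"]] img[OF arcs(6)[of "int i"]]
        unfolding of x Inner of_petersen.simps by blast
      ultimately show ?thesis unfolding e by blast
    qed
  qed
  show "card (parcs ?Y) \<le> card (parcs X)"
    using card_parcs_gen_petersen[of "6 * n" k] by (simp add: card_parcs_X card_carrier_G card_letter)
qed (simp_all only: pair_wf_digraph_X parcs_gen_petersen_subset finite_parcs_gen_petersen)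

lemma digraph_iso_gen_petersen_1:
  assumes "[int n = 1] (mod 3)"
  shows "digraph_iso (with_proj X) (with_proj (gen_petersen (6 * n) (2 * n - 1)))"
proof -
  obtain c where "int n - 1 = 3 * c" using assms unfolding cong_iff_dvd_diff by (rule dvdE)
  then have c: "int n = 3 * c + 1" by simp
  have k: "int (2 * n - 1) = 2 * int n - 1" using n by simp
  have "coprime 3 (int n)"
  proof (rule coprimeI)
    fix d :: int assume "d dvd 3" "d dvd int n"
    then have "d dvd int n - 3 * c" by simp
    then show "is_unit d" by (simp add: c)
  qed
  then show ?thesis by (rule digraph_iso_gen_petersen) (rule inner_mult_1[OF _ c k])
qed

lemma digraph_iso_gen_petersen_2:
  assumes "[int n = - 1] (mod 3)"
  shows "digraph_iso (with_proj X) (with_proj (gen_petersen (6 * n) (2 * n + 1)))"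
proof -
  obtain c where "int n - (- 1) = 3 * c" using assms unfolding cong_iff_dvd_diff by (rule dvdE)
  then have c: "int n = 3 * c - 1" by simp
  have k: "int (2 * n + 1) = 2 * int n + 1" by simp
  have "coprime 3 (int n)"
  proof (rule coprimeI)
    fix d :: int assume "d dvd 3" "d dvd int n"
    then have "d dvd 3 * c - int n" by simp
    then show "is_unit d" by (simp add: c)
  qed
  then show ?thesis by (rule digraph_iso_gen_petersen) (rule inner_mult_2[OF _ c k])
qed

end

section \<open>Isomorphisms and cycles\<close>

lemma closed_path_in_verts:
  assumes "closed_path X xs" "parcs X \<subseteq> pverts X \<times> pverts X"
  shows "set xs \<subseteq> pverts X"
  using assms unfolding closed_path_def by (fastforce simp: in_set_conv_nth)

lemma closed_path_map:
  assumes inj: "inj_on f (pverts X)" and arcs: "map_prod f f ` parcs X \<subseteq> parcs Y"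
    and X: "parcs X \<subseteq> pverts X \<times> pverts X" and xs: "closed_path X xs"
  shows "closed_path Y (map f xs)"
proof -
  have "inj_on f (set xs)" using inj closed_path_in_verts[OF xs X] by (rule inj_on_subset)
  moreover have "(f (xs ! i), f (xs ! (Suc i mod length xs))) \<in> parcs Y" if "i < length xs" for i
  proof -
    have "(xs ! i, xs ! (Suc i mod length xs)) \<in> parcs X" using xs that by (simp add: closed_path_def)
    then have "map_prod f f (xs ! i, xs ! (Suc i mod length xs)) \<in> parcs Y" using arcs by blast
    then show ?thesis by simp
  qed
  moreover have "Suc i mod length xs < length xs" if "i < length xs" for i
    using that by (intro mod_less_divisor) linarith
  ultimately show ?thesis using xs by (simp add: closed_path_def distinct_map)
qed

lemma card_closed_paths_from_iso:
  assumes inj: "inj_on f (pverts X)" and verts: "pverts Y = f ` pverts X"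
    and arcs: "parcs Y = map_prod f f ` parcs X" and X: "parcs X \<subseteq> pverts X \<times> pverts X"
    and uv: "u \<in> pverts X" "v \<in> pverts X"
  shows "card (closed_paths_from Y L (f u) (f v)) = card (closed_paths_from X L u v)"
proof -
  let ?g = "the_inv_into (pverts X) f"
  have Y: "parcs Y \<subseteq> pverts Y \<times> pverts Y" using X unfolding arcs verts by auto
  have g: "inj_on ?g (pverts Y)" using inj_on_the_inv_into[OF inj] unfolding verts .
  have "map_prod ?g ?g ` parcs Y = (\<lambda>e. map_prod ?g ?g (map_prod f f e)) ` parcs X"
    unfolding arcs by (simp add: image_image)
  also have "\<dots> = (\<lambda>e. e) ` parcs X"
    using X by (intro image_cong refl) (auto simp: the_inv_into_f_f[OF inj])
  finally have garcs: "map_prod ?g ?g ` parcs Y \<subseteq> parcs X" by simp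
  have "bij_betw (map f) (closed_paths_from X L u v) (closed_paths_from Y L (f u) (f v))"
    unfolding bij_betw_def
  proof (intro conjI equalityI subsetI)
    show "inj_on (map f) (closed_paths_from X L u v)"
    proof (rule inj_onI)
      fix xs ys assume a: "xs \<in> closed_paths_from X L u v" "ys \<in> closed_paths_from X L u v"
        and eq: "map f xs = map f ys"
      have "set xs \<union> set ys \<subseteq> pverts X"
        using a closed_path_in_verts[OF _ X] unfolding closed_paths_from_def by blast
      then have "inj_on f (set xs \<union> set ys)" using inj by (rule inj_on_subset[rotated])
      then show "xs = ys" using eq by (rule map_inj_on[rotated])
    qed
  next
    fix ys assume "ys \<in> map f ` closed_paths_from X L u v"
    then obtain xs where ys: "ys = map f xs" and xs: "closed_path X xs" "length xs = L"
        "xs ! 0 = u" "xs ! 1 = v" unfolding closed_paths_from_def by blast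
    have "3 \<le> length xs" using xs by (simp add: closed_path_def)
    then have "0 < length xs" "1 < length xs" by linarith+
    then have "ys ! 0 = f u" "ys ! 1 = f v" unfolding ys by (simp_all only: nth_map xs)
    then show "ys \<in> closed_paths_from Y L (f u) (f v)"
      using closed_path_map[OF inj _ X xs(1), of Y] xs(2) arcs
      unfolding closed_paths_from_def by (simp add: ys)
  next
    fix ys assume "ys \<in> closed_paths_from Y L (f u) (f v)"
    then have ys: "closed_path Y ys" "length ys = L" "ys ! 0 = f u" "ys ! 1 = f v"
      unfolding closed_paths_from_def by blast+
    have "3 \<le> length ys" using ys by (simp add: closed_path_def)
    then have len: "0 < length ys" "1 < length ys" by linarith+
    have cl: "closed_path X (map ?g ys)" by (rule closed_path_map[OF g garcs Y ys(1)])
    have "map ?g ys ! 0 = u" "map ?g ys ! 1 = v"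
      using len by (simp_all only: nth_map ys the_inv_into_f_f[OF inj uv(1)] the_inv_into_f_f[OF inj uv(2)])
    with cl ys(2) have "map ?g ys \<in> closed_paths_from X L u v"
      unfolding closed_paths_from_def by simp
    moreover have "map f (map ?g ys) = ys"
    proof -
      have "f (?g y) = y" if "y \<in> set ys" for y
        using that closed_path_in_verts[OF ys(1) Y] unfolding verts
        by (intro f_the_inv_into_f[OF inj]) blast
      then show ?thesis by (simp add: map_idI)
    qed
    ultimately show "ys \<in> map f ` closed_paths_from X L u v" by (metis image_eqI)
  qed
  then show ?thesis by (simp add: bij_betw_same_card)
qed

text \<open>The head and tail functions of the image are \<open>snd\<close> and \<open>fst\<close>,
  which forces the arc map to act by the vertex map.\<close>

lemma digraph_isoE:
  assumes "digraph_iso (with_proj X) (with_proj Y)"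
  obtains f where "inj_on f (pverts X)" "pverts Y = f ` pverts X" "parcs Y = map_prod f f ` parcs X"
proof -
  obtain h where h: "pre_digraph.digraph_isomorphism (with_proj X) h"
    and Y: "with_proj Y = app_iso h (with_proj X)"
    using assms unfolding digraph_iso_def by blast
  let ?f = "iso_verts h"
  have inj: "inj_on ?f (pverts X)"
    using h by (simp add: pre_digraph.digraph_isomorphism_def)
  have verts: "pverts Y = ?f ` pverts X"
    using arg_cong[OF Y, of verts] by simp
  have ht: "iso_tail h = fst" "iso_head h = snd"
    using arg_cong[OF Y, of tail] arg_cong[OF Y, of head] by simp_all
  have "iso_arcs h e = map_prod ?f ?f e" if "e \<in> parcs X" for e
    using h that unfolding pre_digraph.digraph_isomorphism_def ht
    by (auto simp: prod_eq_iff)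
  then have "parcs Y = map_prod ?f ?f ` parcs X"
    using arg_cong[OF Y, of arcs] by (simp cong: image_cong)
  with inj verts show thesis by (rule that)
qed

text \<open>Adding 1 to all indices is an automorphism; induction on \<open>i\<close> moves the edge
  back to index 0.\<close>

lemma card_closed_paths_from_outer:
  assumes "i < m"
  shows "card (closed_paths_from (gen_petersen m k) L (Outer i) (Outer ((i + 1) mod m))) =
    card (closed_paths_from (gen_petersen m k) L (Outer 0) (Outer (1 mod m)))"
proof -
  let ?Y = "gen_petersen m k"
  let ?r = "\<lambda>x. case x of Outer i \<Rightarrow> Outer ((i + 1) mod m) | Inner i \<Rightarrow> Inner ((i + 1) mod m)"
  have m: "m > 0" using assms by simp
  have rot: "a = b" if "Suc a mod m = Suc b mod m" "a < m" "b < m" for a b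
    using that by (simp add: Suc_mod_less split: if_splits)
  have inj: "inj_on ?r (pverts ?Y)"
    unfolding pverts_gen_petersen inj_on_def by (auto dest: rot)
  have fin: "finite (pverts ?Y)" by (simp add: pverts_gen_petersen)
  have "?r ` pverts ?Y \<subseteq> pverts ?Y" using m by (auto simp: pverts_gen_petersen)
  then have verts: "pverts ?Y = ?r ` pverts ?Y" by (rule endo_inj_surj[OF fin _ inj, THEN sym])
  have "map_prod ?r ?r ` petersen_arcs m k \<subseteq> petersen_arcs m k"
  proof -
    have "((a + 1) mod m + l) mod m = ((a + l) mod m + 1) mod m" for a l
      by (simp add: mod_simps add.commute add.left_commute)
    then show ?thesis using m unfolding petersen_arcs_def by (auto simp: mod_simps)
  qed
  then have "map_prod ?r ?r ` parcs ?Y \<subseteq> parcs ?Y"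
    unfolding parcs_gen_petersen by fastforce
  moreover have "inj_on (map_prod ?r ?r) (parcs ?Y)"
    using map_prod_inj_on[OF inj inj] parcs_gen_petersen_subset by (rule inj_on_subset)
  ultimately have arcs: "parcs ?Y = map_prod ?r ?r ` parcs ?Y"
    by (rule endo_inj_surj[OF finite_parcs_gen_petersen, THEN sym])
  show ?thesis
    using assms
  proof (induction i)
    case (Suc i)
    have "Outer i \<in> pverts ?Y" "Outer ((i + 1) mod m) \<in> pverts ?Y"
      using Suc.prems m by (simp_all add: pverts_gen_petersen)
    from card_closed_paths_from_iso[OF inj verts arcs parcs_gen_petersen_subset this, of L]
    show ?case using Suc by simp
  qed simp
qed

section \<open>No isomorphism when 3 divides \<open>n\<close>\<close>

context X_coords
begin

text \<open>This is \<open>(b c)^i\<close>, followed by \<open>b\<close> if \<open>e\<close>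
  holds.\<close>

definition bc_elt :: "int \<times> bool \<Rightarrow> (nat \<Rightarrow> nat) \<times> (int \<times> bool)" where
  "bc_elt = (\<lambda>(i, e). elt (if e then 1 - i else - i, e, i, e))"

definition bc_subgroup :: "((nat \<Rightarrow> nat) \<times> (int \<times> bool)) set" where
  "bc_subgroup = range bc_elt"

lemma bc_subgroup_closed: "h \<in> bc_subgroup \<Longrightarrow> h \<in> carrier G"
  by (auto simp: bc_subgroup_def bc_elt_def)

lemma bc_subgroup_mult:
  assumes "h \<in> bc_subgroup" "s \<noteq> La"
  shows "h \<otimes>\<^bsub>G\<^esub> gen s \<in> bc_subgroup"
proof -
  obtain i e where h: "h = bc_elt (i, e)" using assms(1) by (auto simp: bc_subgroup_def)
  have "1 - i - 2 = - (i + 1)" by simp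
  then have "bc_elt (i, True) \<otimes>\<^bsub>G\<^esub> gen Lb = bc_elt (i, False)"
    "bc_elt (i, False) \<otimes>\<^bsub>G\<^esub> gen Lb = bc_elt (i, True)"
    "bc_elt (i, True) \<otimes>\<^bsub>G\<^esub> gen Lc = bc_elt (i + 1, False)"
    "bc_elt (i, False) \<otimes>\<^bsub>G\<^esub> gen Lc = bc_elt (i - 1, True)"
    by (simp_all only: bc_elt_def elt_mult_gen prod.case if_True if_False simp_thms) simp_all
  then show ?thesis using assms(2) unfolding h bc_subgroup_def by (cases s; cases e) auto
qed

text \<open>If 3 divides \<open>n\<close>, reducing \<open>i\<close> modulo \<open>n\<close>
  preserves it modulo 3, so the component in \<open>D_n\<close> determines the one in
  \<open>S_3\<close>.\<close>

lemma card_bc_subgroup: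
  assumes "3 dvd int n"
  shows "finite bc_subgroup" "card bc_subgroup \<le> 2 * n"
proof -
  have mod: "bc_elt (i, e) = bc_elt (i mod int n, e)" for i e
  proof -
    have "3 dvd i - i mod int n" using assms by (simp add: minus_mod_eq_mult_div)
    then have "3 dvd - (i - i mod int n)" by (simp only: dvd_minus_iff)
    then show ?thesis by (simp add: bc_elt_def elt_eq_iff mod_eq_dvd_iff)
  qed
  then have sub: "bc_subgroup \<subseteq> bc_elt ` ({0..<int n} \<times> UNIV)"
  proof (intro subsetI)
    fix h assume "h \<in> bc_subgroup"
    then obtain i e where "h = bc_elt (i, e)" unfolding bc_subgroup_def by (metis imageE surj_pair)
    then have "h = bc_elt (i mod int n, e)" using mod by metis
    moreover have "(i mod int n, e) \<in> {0..<int n} \<times> UNIV" using n by simp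
    ultimately show "h \<in> bc_elt ` ({0..<int n} \<times> UNIV)" by (rule image_eqI)
  qed
  have fin: "finite (bc_elt ` ({0..<int n} \<times> UNIV))" by simp
  show "finite bc_subgroup" using sub fin by (rule finite_subset)
  have "card bc_subgroup \<le> card (bc_elt ` ({0..<int n} \<times> UNIV))" by (rule card_mono[OF fin sub])
  also have "\<dots> \<le> card ({0..<int n} \<times> (UNIV :: bool set))" by (rule card_image_le) simp
  also have "\<dots> = 2 * n" by (simp add: card_cartesian_product)
  finally show "card bc_subgroup \<le> 2 * n" .
qed

text \<open>The outer cycle pulls back to a walk in \<open>X\<close> whose edges lie on equally many
  8-cycles, so its steps are all \<open>a\<close> or never \<open>a\<close>. The first kind returns
  too early; the second stays in a coset too small for \<open>6 * n\<close> vertices.\<close>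

lemma not_digraph_iso_gen_petersen:
  assumes "n \<ge> 4" "3 dvd int n"
  shows "\<not> digraph_iso (with_proj X) (with_proj (gen_petersen m k))"
proof
  let ?Y = "gen_petersen m k"
  assume "digraph_iso (with_proj X) (with_proj ?Y)"
  then obtain f where inj: "inj_on f (pverts X)" and verts: "pverts ?Y = f ` pverts X"
    and arcs: "parcs ?Y = map_prod f f ` parcs X" by (rule digraph_isoE)
  have X: "parcs X \<subseteq> pverts X \<times> pverts X" by (auto simp: parcs_X_iff)
  have "2 * m = 12 * n"
    using card_pverts_gen_petersen[of m k] card_image[OF inj] unfolding verts
    by (simp add: card_carrier_G)
  then have m: "m = 6 * n" by simp
  have m0: "m > 0" using m n by simp
  \<comment> \<open>Indices run over all natural numbers and are read modulo \<open>m\<close>, which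
    spares the closing edge a separate treatment.\<close>
  have "\<forall>i. \<exists>g. g \<in> carrier G \<and> f g = Outer (i mod m)"
  proof
    fix i
    have "Outer (i mod m) \<in> pverts ?Y" using m0 by (simp add: pverts_gen_petersen)
    then show "\<exists>g. g \<in> carrier G \<and> f g = Outer (i mod m)"
      unfolding verts pverts_X by (metis imageE)
  qed
  then obtain g where g: "\<And>i. g i \<in> carrier G" "\<And>i. f (g i) = Outer (i mod m)" by metis
  have "\<exists>s. g (Suc i) = g i \<otimes>\<^bsub>G\<^esub> gen s" for i
  proof -
    have "(Outer (i mod m), Outer (Suc i mod m)) \<in> petersen_arcs m k"
      unfolding petersen_arcs_def using m0 by (auto simp: mod_simps intro!: image_eqI[of _ _ "i mod m"])
    then have "(f (g i), f (g (Suc i))) \<in> map_prod f f ` parcs X"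
      unfolding g(2) arcs[symmetric] parcs_gen_petersen by blast
    then obtain x y where xy: "(x, y) \<in> parcs X" "f (g i) = f x" "f (g (Suc i)) = f y" by auto
    have "x \<in> carrier G" "y \<in> carrier G" using xy(1) X by auto
    then have "g i = x" "g (Suc i) = y" using inj xy(2,3) g(1) by (auto dest: inj_onD)
    then show ?thesis using xy(1) by (simp add: parcs_X_iff)
  qed
  then obtain s where s: "\<And>i. g (Suc i) = g i \<otimes>\<^bsub>G\<^esub> gen (s i)" by metis
  have count: "card (closed_paths_from X 8 (g i) (g (Suc i))) = (case s i of La \<Rightarrow> 6 | _ \<Rightarrow> 5)" for i
  proof -
    have "card (closed_paths_from X 8 (g i) (g i \<otimes>\<^bsub>G\<^esub> gen (s i))) = card (relations 8 (s i))"
      by (rule card_closed_paths_from[OF g(1)]) (simp, rule shorter_8[OF assms(1)])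
    then show ?thesis unfolding s card_relations_8[OF assms(1)] .
  qed
  have const: "card (closed_paths_from X 8 (g i) (g (Suc i))) = card (closed_paths_from X 8 (g 0) (g 1))" for i
  proof -
    have iso: "card (closed_paths_from X 8 (g i) (g (Suc i))) =
        card (closed_paths_from ?Y 8 (Outer (i mod m)) (Outer ((i mod m + 1) mod m)))" for i
      using card_closed_paths_from_iso[OF inj verts arcs X, of "g i" "g (Suc i)" 8] g
      by (simp add: mod_simps)
    have "card (closed_paths_from X 8 (g i) (g (Suc i))) =
        card (closed_paths_from ?Y 8 (Outer 0) (Outer (1 mod m)))" for i
      unfolding iso by (rule card_closed_paths_from_outer) (use m0 in simp)
    from this[of i] this[of 0] show ?thesis by simp
  qed
  \<comment> \<open>The counts are 6 for \<open>La\<close> and 5 for the other letters, and they are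
    constant along the walk.\<close>
  have same: "s i = La \<longleftrightarrow> s 0 = La" for i
    using const[of i] count[of i] count[of 0] by (cases "s i"; cases "s 0") simp_all
  have inj_g: "inj_on g {..<m}"
  proof (rule inj_onI)
    fix i j assume ij: "i \<in> {..<m}" "j \<in> {..<m}" and "g i = g j"
    then have "Outer (i mod m) = Outer (j mod m)" by (metis g(2))
    then show "i = j" using ij by simp
  qed
  have "s 0 \<noteq> La"
  proof
    assume "s 0 = La"
    \<comment> \<open>Two successive steps along \<open>a\<close> cancel, although
      \<open>g 0\<close> and \<open>g 2\<close> correspond to different outer vertices.\<close>
    then have "g 2 = g 0" using s[of 0] s[of 1] same[of 1] g(1) by (simp add: numeral_2_eq_2)
    then show False using inj_onD[OF inj_g, of 2 0] m n by simp
  qed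
  have "g i \<in> (\<lambda>h. g 0 \<otimes>\<^bsub>G\<^esub> h) ` bc_subgroup" for i
  proof (induction i)
    case 0
    have "\<one>\<^bsub>G\<^esub> \<in> bc_subgroup"
      unfolding bc_subgroup_def one_elt by (rule range_eqI[of _ _ "(0, False)"]) (simp add: bc_elt_def)
    then show ?case using g(1) by (intro image_eqI[of _ _ "\<one>\<^bsub>G\<^esub>"]) simp_all
  next
    case (Suc i)
    then obtain h where h: "h \<in> bc_subgroup" "g i = g 0 \<otimes>\<^bsub>G\<^esub> h" by blast
    have "g (Suc i) = g 0 \<otimes>\<^bsub>G\<^esub> (h \<otimes>\<^bsub>G\<^esub> gen (s i))"
      unfolding s h(2) using g(1) bc_subgroup_closed[OF h(1)] by (simp add: m_assoc)
    moreover have "h \<otimes>\<^bsub>G\<^esub> gen (s i) \<in> bc_subgroup"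
      using h(1) same \<open>s 0 \<noteq> La\<close> by (intro bc_subgroup_mult) simp_all
    ultimately show ?case by (rule image_eqI)
  qed
  then have "g ` {..<m} \<subseteq> (\<lambda>h. g 0 \<otimes>\<^bsub>G\<^esub> h) ` bc_subgroup" by blast
  then have "card (g ` {..<m}) \<le> card ((\<lambda>h. g 0 \<otimes>\<^bsub>G\<^esub> h) ` bc_subgroup)"
    using card_bc_subgroup(1)[OF assms(2)] by (intro card_mono) simp_all
  also have "\<dots> \<le> card bc_subgroup"
    using card_bc_subgroup(1)[OF assms(2)] by (rule card_image_le)
  also have "\<dots> \<le> 2 * n" by (rule card_bc_subgroup(2)[OF assms(2)])
  finally have "m \<le> 2 * n" by (simp only: card_image[OF inj_g] card_lessThan)
  then show False using m n by simp
qed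

end

theorem theorem4p7:
  fixes n :: nat
  assumes "n \<ge> 3"
  shows
    "(pair_graph (X_graph n) \<and> Digraph_Component.connected (with_proj (X_graph n)) \<and>
      vertex_transitive (X_graph n) \<and> rainbow_domination_regular3 (X_graph n) \<and>
      card (pverts (X_graph n)) = 12 * n) \<and>
     girth (X_graph 3) = 6 \<and> has_signature (X_graph 3) [0, 1, 1] \<and>
     (n \<ge> 4 \<longrightarrow>
        girth (X_graph n) = 8 \<and> has_signature (X_graph n) [5, 5, 6] \<and>
        ([int n = 1] (mod 3) \<longrightarrow>
           digraph_iso (with_proj (X_graph n)) (with_proj (gen_petersen (6 * n) (2 * n - 1)))) \<and>
        ([int n = - 1] (mod 3) \<longrightarrow>
           digraph_iso (with_proj (X_graph n)) (with_proj (gen_petersen (6 * n) (2 * n + 1)))) \<and>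
        ([int n = 0] (mod 3) \<longrightarrow>
           (\<forall>m k. 1 \<le> k \<and> 2 * k \<le> m \<longrightarrow>
              \<not> digraph_iso (with_proj (X_graph n)) (with_proj (gen_petersen m k)))))"
proof -
  interpret X_coords n by standard (rule assms)
  \<comment> \<open>Part (i) concerns the graph for 3 whatever \<open>n\<close> is, hence a second
    interpretation.\<close>
  interpret X3: X_coords 3 by standard simp
  have iso0: "\<not> digraph_iso (with_proj X) (with_proj (gen_petersen m k))"
    if "n \<ge> 4" "[int n = 0] (mod 3)" for m k
    using that by (intro not_digraph_iso_gen_petersen) (simp_all add: cong_0_iff)
  have "card (pverts X) = 12 * n" by (simp add: card_carrier_G)
  then show ?thesis
    unfolding X_graph_eq X3.X_graph_eq
    using pair_graph_X connected_X[OF word_surj] vertex_transitive_X rainbow_domination_regular3_X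
      X3.girth_signature_3[OF refl] girth_signature_8
      digraph_iso_gen_petersen_1 digraph_iso_gen_petersen_2 iso0
    by blast
qed

end
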